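(* Let $\mathcal{H}_S$ and $\mathcal{H}_A$ be Hilbert spaces of the same finite dimension $d$, and let $\Lambda=\{\Lambda_t\}_t$ be an invertible dynamics on $\mathcal{H}_S$ (a time-parametrized family of completely positive trace-preserving linear maps on $\mathcal{L}(\mathcal{H}_S)$, each of which is invertible as a linear map). Then the following are equivalent: (i) $\Lambda$ is GTDE-Markovian; (ii) $\Lambda$ is completely positive divisible (CPD); (iii) $\Lambda$ is SA-Markovian, or, equivalently, IB-Markovian; (iv) $\Lambda$ is $2$-SA-Markovian.
   Context: Setting. $\mathcal{H}_S$ (system) and $\mathcal{H}_A$ (ancilla) are complex Hilbert spaces of the same finite dimension $d$. $\mathcal{L}(\mathcal{H})$ is the space of linear operators on $\mathcal{H}$, and $\mathcal{P}_+(\mathcal{H})$ is the set of density matrices on $\mathcal{H}$. A dynamics (dynamical map) is a family $\Lambda=\{\Lambda_t\}_{t\ge 0}$ of completely positive trace-preserving (CPTP) linear maps $\Lambda_t:\mathcal{L}(\mathcal{H}_S)\to\mathcal{L}(\mathcal{H}_S)$ indexed by time $t$; it is invertible if $\Lambda_t$ is invertible as a linear map for all $t$. $I$ denotes the identity map on $\mathcal{L}(\mathcal{H}_A)$. $\|A\|_1=\mathrm{Tr}\sqrt{A^\dagger A}$. Divisibility. $\Lambda$ is divisible if for all $t>s$ there is a linear map $V_{t,s}:\mathcal{L}(\mathcal{H}_S)\to\mathcal{L}(\mathcal{H}_S)$ with $\Lambda_t=V_{t,s}\Lambda_s$ (unique when $\Lambda$ is invertible). $\Lambda$ is completely positive divisible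 (CPD) if $V_{t,s}$ is completely positive for all $t>s$. Ensembles. A system ensemble of size $n$ is a collection $\mathcal{E}_S=\{p_i;\rho_i\}_{i=1}^n$ with $p_i\ge 0$, $\sum_i p_i=1$, $\rho_i\in\mathcal{P}_+(\mathcal{H}_S)$. A system-ancilla ensemble of size $n$ is a collection $\mathcal{E}_{SA}=\{p_i;\xi_i\}_{i=1}^n$ with $p_i\ge 0$, $\sum_i p_i=1$, $\xi_i\in\mathcal{P}_+(\mathcal{H}_S\otimes\mathcal{H}_A)$. $\mathcal{F}_S^n$ and $\mathcal{F}_{SA}^n$ are the sets of all such ensembles of size $n$; $\mathcal{F}_S=\bigcup_{n\ge1}\mathcal{F}_S^n$ and $\mathcal{F}_{SA}=\bigcup_{n\ge1}\mathcal{F}_{SA}^n$. Physicality quantifiers (PQ). A system PQ is a bounded nonnegative real function $\mathcal{I}_S:\mathcal{F}_S\to\mathbb{R}$ such that $\mathcal{I}_S\{p_i;T[\rho_i]\}\le\mathcal{I}_S\{p_i;\rho_i\}$ for every CPTP map $T$ on $\mathcal{L}(\mathcal{H}_S)$ and every ensemble. A system-ancilla PQ is a bounded nonnegative real function $\mathcal{I}_{SA}:\mathcal{F}_{SA}\to\mathbb{R}$ such that $\mathcal{I}_{SA}\{p_i;(T\otimes I)[\xi_i]\}\le\mathcal{I}_{SA}\{p_i;\xi_i\}$ for every CPTP map $T$ on $\mathcal{L}(\mathcal{H}_S)$ and every ensemble. A PQ of the form $\mathcal{I}_S^n$ (resp. $\mathcal{I}_{SA}^n$) is a system (resp. system-ancilla)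 PQ that vanishes on every ensemble not in $\mathcal{F}_S^n$ (resp. $\mathcal{F}_{SA}^n$). Dynamic PQ. $\Phi_t^{\mathcal{I}_S}\{p_i;\rho_i\}:=\mathcal{I}_S\{p_i;\Lambda_t[\rho_i]\}$ and $\Phi_t^{\mathcal{I}_{SA}}\{p_i;\xi_i\}:=\mathcal{I}_{SA}\{p_i;(\Lambda_t\otimes I)[\xi_i]\}$. Markovianity. "Decreases monotonically" means non-increasing. $\Lambda$ is $n$-S-Markovian (resp. $n$-SA-Markovian) if for every PQ of the form $\mathcal{I}_S^n$ (resp. $\mathcal{I}_{SA}^n$) and every ensemble $\mathcal{E}_S\in\mathcal{F}_S^n$ (resp. $\mathcal{E}_{SA}\in\mathcal{F}_{SA}^n$), $\Phi_t^{\mathcal{I}_S^n}(\mathcal{E}_S)$ (resp. $\Phi_t^{\mathcal{I}_{SA}^n}(\mathcal{E}_{SA})$) decreases monotonically with $t$. $\Lambda$ is S-Markovian (resp. SA-Markovian) if it is $n$-S-Markovian (resp. $n$-SA-Markovian) for every $n\ge 1$. $\Lambda$ is IB-Markovian if it is both S-Markovian and SA-Markovian. GTDE. The extended generalized trace-distance quantifier is the system-ancilla PQ given by $\mathcal{I}_{SA}^{GTDE}\{p_1,p_2,\xi_1,\xi_2\}:=\|p_1\xi_1-p_2\xi_2\|_1$ on $\mathcal{F}_{SA}^2$ and $0$ on ensembles not in $\mathcal{F}_{SA}^2$. $\Lambda$ is GTDE-Markovian if $\Phi_t^{\mathcal{I}_{SA}^{GTDE}}(\mathcal{E}_{SA})$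 decreases monotonically with $t$ for every $\mathcal{E}_{SA}\in\mathcal{F}_{SA}$; that is, $t\mapsto\|p_1(\Lambda_t\otimes I)[\xi_1]-p_2(\Lambda_t\otimes I)[\xi_2]\|_1$ is non-increasing for all probabilities $p_1+p_2=1$ and all $\xi_1,\xi_2\in\mathcal{P}_+(\mathcal{H}_S\otimes\mathcal{H}_A)$. *)

theory Defs
  imports "HOL-Analysis.Analysis"
begin

section \<open>Operators on finite-dimensional complex Hilbert spaces\<close>

text \<open>
  A Hilbert space of dimension \<open>CARD('n)\<close> is \<open>complex ^ 'n\<close>; its operators are given by their
  matrices in an orthonormal basis. The tensor product of \<open>complex ^ 's\<close> and \<open>complex ^ 'a\<close>
  is \<open>complex ^ ('s \<times> 'a)\<close>.
\<close>

type_synonym 'n op = "complex ^ 'n ^ 'n"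

definition cinner :: "complex ^ 'n \<Rightarrow> complex ^ 'n \<Rightarrow> complex" where
  "cinner u v = (\<Sum>i\<in>UNIV. cnj (u $ i) * v $ i)"

definition dagger :: "'n::finite op \<Rightarrow> 'n op" where
  "dagger A = map_matrix cnj (transpose A)"

definition cscale :: "complex \<Rightarrow> 'n::finite op \<Rightarrow> 'n op" where
  "cscale c A = map_matrix ((*) c) A"

text \<open>Membership in \<open>\<real>\<^sub>\<ge>\<^sub>0\<close> includes being real, hence \<open>psd\<close> operators are Hermitian.\<close>

definition psd :: "'n::finite op \<Rightarrow> bool" where
  "psd A \<longleftrightarrow> (\<forall>v. cinner v (A *v v) \<in> \<real>\<^sub>\<ge>\<^sub>0)"

definition density :: "'n::finite op set" where
  "density = {\<rho>. psd \<rho> \<and> trace \<rho> = 1}"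

definition psd_sqrt :: "'n::finite op \<Rightarrow> 'n op" where
  "psd_sqrt A = (THE R. psd R \<and> R ** R = A)"

definition trace_norm :: "'n::finite op \<Rightarrow> real" where
  "trace_norm A = Re (trace (psd_sqrt (dagger A ** A)))"


section \<open>Linear maps on operators\<close>

definition op_linear :: "('n::finite op \<Rightarrow> 'm::finite op) \<Rightarrow> bool" where
  "op_linear T \<longleftrightarrow> Vector_Spaces.linear cscale cscale T"

text \<open>
  An operator on \<open>complex ^ 'n\<close> tensored with a \<open>k\<close>-dimensional space is a \<open>k \<times> k\<close> array of blocks
  \<open>X a b\<close> (\<open>a, b < k\<close>), and a map \<open>T\<close> tensored with the identity acts on it blockwise. The array
  form lets the dimension \<open>k\<close> of the auxiliary space be quantified.
\<close>

definition psd_blocks :: "nat \<Rightarrow> (nat \<Rightarrow> nat \<Rightarrow> 'n::finite op) \<Rightarrow> bool" where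
  "psd_blocks k X \<longleftrightarrow>
     (\<forall>v :: nat \<Rightarrow> complex ^ 'n. (\<Sum>a<k. \<Sum>b<k. cinner (v a) (X a b *v v b)) \<in> \<real>\<^sub>\<ge>\<^sub>0)"

definition completely_positive :: "('n::finite op \<Rightarrow> 'm::finite op) \<Rightarrow> bool" where
  "completely_positive T \<longleftrightarrow>
     (\<forall>k X. psd_blocks k X \<longrightarrow> psd_blocks k (\<lambda>a b. T (X a b)))"

definition trace_preserving :: "('n::finite op \<Rightarrow> 'm::finite op) \<Rightarrow> bool" where
  "trace_preserving T \<longleftrightarrow> (\<forall>A. trace (T A) = trace A)"

definition cptp :: "('n::finite op \<Rightarrow> 'n op) set" where
  "cptp = {T. op_linear T \<and> completely_positive T \<and> trace_preserving T}"

definition invertible_map :: "('n::finite op \<Rightarrow> 'n op) \<Rightarrow> bool" where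
  "invertible_map T \<longleftrightarrow> (\<exists>T'. op_linear T' \<and> T' \<circ> T = id \<and> T \<circ> T' = id)"

text \<open>\<open>tensor_id T\<close> is \<open>T\<close> tensored with the identity map on the operators of \<open>complex ^ 'a\<close>.\<close>

definition tensor_id ::
    "('s::finite op \<Rightarrow> 's op) \<Rightarrow> ('s \<times> 'a::finite) op \<Rightarrow> ('s \<times> 'a) op" where
  "tensor_id T X =
     (\<chi> r c. T (\<chi> i j. X $ (i, snd r) $ (j, snd c)) $ fst r $ fst c)"

definition kron :: "'s::finite op \<Rightarrow> 'a::finite op \<Rightarrow> ('s \<times> 'a) op" where
  "kron A B = (\<chi> r c. A $ fst r $ fst c * B $ snd r $ snd c)"

lemma vector_space_cscale: "vector_space (cscale :: complex \<Rightarrow> 'n::finite op \<Rightarrow> 'n op)"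
  by unfold_locales (simp_all add: cscale_def vec_eq_iff algebra_simps)

lemma cscale_nth: "cscale c A $ i $ j = c * A $ i $ j"
  by (simp add: cscale_def)

lemma op_linear_iff:
  "op_linear T \<longleftrightarrow> (\<forall>A B. T (A + B) = T A + T B) \<and> (\<forall>c A. T (cscale c A) = cscale c (T A))"
  by (simp add: op_linear_def Vector_Spaces.linear_def module_hom_def module_hom_axioms_def
      vector_space_cscale vector_space_cscale[unfolded module_iff_vector_space[symmetric]])

text \<open>
  Since the operators \<open>kron A B\<close> span, the next two facts determine \<open>tensor_id T\<close>.
\<close>

lemma tensor_id_kron:
  assumes "op_linear T"
  shows "tensor_id T (kron A B) = kron (T A) B"
proof -
  have "(\<chi> i j. kron A B $ (i, a) $ (j, b)) = cscale (B $ a $ b) A" for a b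
    by (simp add: kron_def cscale_def vec_eq_iff)
  moreover have "T (cscale c A) = cscale c (T A)" for c
    using assms unfolding op_linear_iff by blast
  ultimately have "tensor_id T (kron A B) $ r $ s = kron (T A) B $ r $ s" for r s
    by (simp only: tensor_id_def kron_def vec_lambda_beta prod.collapse fst_conv snd_conv
        cscale_nth mult.commute)
  then show ?thesis
    by (intro vec_eq_iff[THEN iffD2] allI)
qed

lemma op_linear_tensor_id:
  assumes "op_linear T"
  shows "op_linear (tensor_id T)"
proof -
  have T_add: "T (A + B) = T A + T B" and T_scale: "T (cscale c A) = cscale c (T A)" for A B c
    using assms unfolding op_linear_iff by blast+
  have add: "(\<chi> i j. A $ (i, a) $ (j, b) + B $ (i, a) $ (j, b)) =
      (\<chi> i j. A $ (i, a) $ (j, b)) + (\<chi> i j. B $ (i, a) $ (j, b))"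
    for A B :: "('a \<times> 'b) op" and a b
    by (simp add: vec_eq_iff)
  have scale: "(\<chi> i j. c * A $ (i, a) $ (j, b)) = cscale c (\<chi> i j. A $ (i, a) $ (j, b))"
    for A :: "('a \<times> 'b) op" and a b c
    by (simp add: cscale_def vec_eq_iff)
  show ?thesis
    unfolding op_linear_iff
  proof (intro conjI allI)
    fix A B :: "('a \<times> 'b) op" and c
    have "tensor_id T (A + B) $ r $ s = (tensor_id T A + tensor_id T B) $ r $ s" for r s
      by (simp only: tensor_id_def vec_lambda_beta vector_add_component add T_add)
    then show "tensor_id T (A + B) = tensor_id T A + tensor_id T B"
      by (intro vec_eq_iff[THEN iffD2] allI)
    have "tensor_id T (cscale c A) $ r $ s = cscale c (tensor_id T A) $ r $ s" for r s
      by (simp only: tensor_id_def vec_lambda_beta cscale_nth scale T_scale)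
    then show "tensor_id T (cscale c A) = cscale c (tensor_id T A)"
      by (intro vec_eq_iff[THEN iffD2] allI)
  qed
qed


section \<open>Dynamics\<close>

definition dynamics :: "(real \<Rightarrow> 's::finite op \<Rightarrow> 's op) \<Rightarrow> bool" where
  "dynamics \<Lambda> \<longleftrightarrow> (\<forall>t\<ge>0. \<Lambda> t \<in> cptp)"

definition invertible_dynamics :: "(real \<Rightarrow> 's::finite op \<Rightarrow> 's op) \<Rightarrow> bool" where
  "invertible_dynamics \<Lambda> \<longleftrightarrow> dynamics \<Lambda> \<and> (\<forall>t\<ge>0. invertible_map (\<Lambda> t))"

definition propagator ::
    "(real \<Rightarrow> 's::finite op \<Rightarrow> 's op) \<Rightarrow> (real \<Rightarrow> real \<Rightarrow> 's op \<Rightarrow> 's op) \<Rightarrow> bool" where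
  "propagator \<Lambda> V \<longleftrightarrow> (\<forall>s t. 0 \<le> s \<and> s < t \<longrightarrow> op_linear (V t s) \<and> \<Lambda> t = V t s \<circ> \<Lambda> s)"

definition CPD :: "(real \<Rightarrow> 's::finite op \<Rightarrow> 's op) \<Rightarrow> bool" where
  "CPD \<Lambda> \<longleftrightarrow>
     (\<exists>V. propagator \<Lambda> V \<and> (\<forall>s t. 0 \<le> s \<and> s < t \<longrightarrow> completely_positive (V t s)))"


section \<open>Ensembles and physicality quantifiers\<close>

type_synonym 'n ensemble = "(real \<times> 'n op) list"

definition ensembles_of_size :: "nat \<Rightarrow> 'n::finite ensemble set" where
  "ensembles_of_size n =
     {E. length E = n \<and> (\<forall>(p, \<rho>)\<in>set E. 0 \<le> p \<and> \<rho> \<in> density) \<and> sum_list (map fst E) = 1}"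

definition ensembles :: "'n::finite ensemble set" where
  "ensembles = (\<Union>n\<in>{1..}. ensembles_of_size n)"

definition apply_ensemble :: "('n op \<Rightarrow> 'n op) \<Rightarrow> 'n ensemble \<Rightarrow> 'n ensemble" where
  "apply_ensemble T E = map (\<lambda>(p, \<rho>). (p, T \<rho>)) E"

text \<open>
  Quantifiers are total functions on lists, but only their values on \<open>ensembles\<close> matter.
\<close>

definition quantifier :: "('n::finite op \<Rightarrow> 'n op) set \<Rightarrow> ('n ensemble \<Rightarrow> real) \<Rightarrow> bool" where
  "quantifier \<T> I \<longleftrightarrow>
     (\<exists>B. \<forall>E\<in>ensembles. I E \<le> B) \<and>
     (\<forall>E\<in>ensembles. 0 \<le> I E) \<and>
     (\<forall>T\<in>\<T>. \<forall>E\<in>ensembles. I (apply_ensemble T E) \<le> I E)"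

definition S_PQ :: "('s::finite ensemble \<Rightarrow> real) \<Rightarrow> bool" where
  "S_PQ I \<longleftrightarrow> quantifier cptp I"

definition SA_PQ :: "(('s::finite \<times> 'a::finite) ensemble \<Rightarrow> real) \<Rightarrow> bool" where
  "SA_PQ I \<longleftrightarrow> quantifier (tensor_id ` cptp) I"

definition supported_on_size :: "nat \<Rightarrow> ('n::finite ensemble \<Rightarrow> real) \<Rightarrow> bool" where
  "supported_on_size n I \<longleftrightarrow> (\<forall>E\<in>ensembles - ensembles_of_size n. I E = 0)"

definition S_dynamic ::
    "(real \<Rightarrow> 's::finite op \<Rightarrow> 's op) \<Rightarrow> ('s ensemble \<Rightarrow> real) \<Rightarrow> 's ensemble \<Rightarrow> real \<Rightarrow> real" where
  "S_dynamic \<Lambda> I E t = I (apply_ensemble (\<Lambda> t) E)"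

definition SA_dynamic ::
    "(real \<Rightarrow> 's::finite op \<Rightarrow> 's op) \<Rightarrow> (('s \<times> 'a::finite) ensemble \<Rightarrow> real) \<Rightarrow>
     ('s \<times> 'a) ensemble \<Rightarrow> real \<Rightarrow> real" where
  "SA_dynamic \<Lambda> I E t = I (apply_ensemble (tensor_id (\<Lambda> t)) E)"


section \<open>Markovianity\<close>

text \<open>The \<open>'a itself\<close> argument fixes the ancilla, which does not occur in the type of \<open>\<Lambda>\<close>.\<close>

definition n_S_Markovian :: "nat \<Rightarrow> (real \<Rightarrow> 's::finite op \<Rightarrow> 's op) \<Rightarrow> bool" where
  "n_S_Markovian n \<Lambda> \<longleftrightarrow>
     (\<forall>I. S_PQ I \<and> supported_on_size n I \<longrightarrow>
        (\<forall>E\<in>ensembles_of_size n. antimono_on {0..} (S_dynamic \<Lambda> I E)))"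

definition n_SA_Markovian ::
    "'a::finite itself \<Rightarrow> nat \<Rightarrow> (real \<Rightarrow> 's::finite op \<Rightarrow> 's op) \<Rightarrow> bool" where
  "n_SA_Markovian A n \<Lambda> \<longleftrightarrow>
     (\<forall>I :: ('s \<times> 'a) ensemble \<Rightarrow> real. SA_PQ I \<and> supported_on_size n I \<longrightarrow>
        (\<forall>E\<in>ensembles_of_size n. antimono_on {0..} (SA_dynamic \<Lambda> I E)))"

definition S_Markovian :: "(real \<Rightarrow> 's::finite op \<Rightarrow> 's op) \<Rightarrow> bool" where
  "S_Markovian \<Lambda> \<longleftrightarrow> (\<forall>n\<ge>1. n_S_Markovian n \<Lambda>)"

definition SA_Markovian ::
    "'a::finite itself \<Rightarrow> (real \<Rightarrow> 's::finite op \<Rightarrow> 's op) \<Rightarrow> bool" where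
  "SA_Markovian A \<Lambda> \<longleftrightarrow> (\<forall>n\<ge>1. n_SA_Markovian A n \<Lambda>)"

definition IB_Markovian ::
    "'a::finite itself \<Rightarrow> (real \<Rightarrow> 's::finite op \<Rightarrow> 's op) \<Rightarrow> bool" where
  "IB_Markovian A \<Lambda> \<longleftrightarrow> S_Markovian \<Lambda> \<and> SA_Markovian A \<Lambda>"

fun GTDE :: "('s::finite \<times> 'a::finite) ensemble \<Rightarrow> real" where
  "GTDE [(p\<^sub>1, \<xi>\<^sub>1), (p\<^sub>2, \<xi>\<^sub>2)] = trace_norm (p\<^sub>1 *\<^sub>R \<xi>\<^sub>1 - p\<^sub>2 *\<^sub>R \<xi>\<^sub>2)"
| "GTDE _ = 0"

definition GTDE_Markovian ::
    "'a::finite itself \<Rightarrow> (real \<Rightarrow> 's::finite op \<Rightarrow> 's op) \<Rightarrow> bool" where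
  "GTDE_Markovian A \<Lambda> \<longleftrightarrow>
     (\<forall>E :: ('s \<times> 'a) ensemble \<in> ensembles. antimono_on {0..} (SA_dynamic \<Lambda> GTDE E))"

end

theory Submission
  imports Defs
begin

text \<open>
  Completely positive propagators are automatically trace preserving, because each \<open>\<Lambda> s\<close> is onto, so
  complete positive divisibility makes every quantifier decrease. Conversely, the trace-distance
  quantifier is a quantifier on ensembles of size two, since a positive trace-preserving map
  contracts the trace norm. A Hermitian operator is, up to scaling, of the form
  \<open>p\<^sub>1 \<xi>\<^sub>1 - p\<^sub>2 \<xi>\<^sub>2\<close>; so if this quantifier decreases, then the propagator tensored with the identity
  contracts the trace norm on all Hermitian operators. Together with trace preservation this makes
  it positive, and by Choi's theorem the propagator is completely positive.
\<close>

section \<open>Hermitian and positive operators\<close>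

lemma cinner_add_left: "cinner (u + v) w = cinner u w + cinner v w"
  by (simp add: cinner_def algebra_simps sum.distrib)

lemma cinner_add_right: "cinner w (u + v) = cinner w u + cinner w v"
  by (simp add: cinner_def algebra_simps sum.distrib)

lemma cinner_diff_right: "cinner w (u - v) = cinner w u - cinner w v"
  by (simp add: cinner_def algebra_simps sum_subtractf)

lemma cinner_scale_left: "cinner (c *s u) w = cnj c * cinner u w"
  by (simp add: cinner_def algebra_simps sum_distrib_left)

lemma cinner_scale_right: "cinner w (c *s u) = c * cinner w u"
  by (simp add: cinner_def algebra_simps sum_distrib_left)

lemma cinner_zero_left [simp]: "cinner 0 w = 0"
  by (simp add: cinner_def)

lemma cinner_zero_right [simp]: "cinner w 0 = 0"
  by (simp add: cinner_def)

lemma cinner_sum_right: "cinner w (\<Sum>b\<in>B. f b) = (\<Sum>b\<in>B. cinner w (f b))"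
  by (induction B rule: infinite_finite_induct) (simp_all add: cinner_add_right)

lemma cnj_cinner: "cnj (cinner u v) = cinner v u"
  by (simp add: cinner_def mult.commute)

lemma Re_cinner: "Re (cinner u v) = u \<bullet> v"
  by (simp add: cinner_def inner_vec_def inner_complex_def)

lemma cinner_self: "cinner v v = of_real ((norm v)\<^sup>2)"
proof (rule complex_eqI)
  show "Re (cinner v v) = Re (of_real ((norm v)\<^sup>2))"
    by (simp add: Re_cinner power2_norm_eq_inner)
  show "Im (cinner v v) = Im (of_real ((norm v)\<^sup>2))"
    using cnj_cinner[of v v] by (simp add: complex_eq_iff)
qed

lemma cinner_self_eq_0 [simp]: "cinner v v = 0 \<longleftrightarrow> v = 0"
  by (simp add: cinner_self)

lemma cinner_axis: "cinner (axis i 1) v = v $ i"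
  by (simp add: cinner_def axis_def if_distrib [of cnj] if_distrib [of "\<lambda>x. x * _"] cong: if_cong)

lemma scaleR_vector_scalar: "r *\<^sub>R v = complex_of_real r *s v"
  unfolding vec_eq_iff vector_scaleR_component vector_smult_component
  by (simp add: scaleR_conv_of_real)

lemma dagger_nth: "dagger A $ i $ j = cnj (A $ j $ i)"
  by (simp add: dagger_def transpose_def)

lemma dagger_dagger [simp]: "dagger (dagger A) = A"
  by (simp add: vec_eq_iff dagger_nth)

lemma dagger_add: "dagger (A + B) = dagger A + dagger B"
  by (simp add: vec_eq_iff dagger_nth)

lemma dagger_diff: "dagger (A - B) = dagger A - dagger B"
  by (simp add: vec_eq_iff dagger_nth)

lemma dagger_scaleR: "dagger (r *\<^sub>R A) = r *\<^sub>R dagger A"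
  by (simp add: vec_eq_iff dagger_nth)

lemma dagger_cscale: "dagger (cscale c A) = cscale (cnj c) (dagger A)"
  by (simp add: vec_eq_iff dagger_nth cscale_nth)

lemma cinner_dagger: "cinner u (A *v v) = cinner (dagger A *v u) v"
proof -
  have "cinner u (A *v v) = (\<Sum>i\<in>UNIV. \<Sum>j\<in>UNIV. cnj (u $ i) * (A $ i $ j * v $ j))"
    by (simp add: cinner_def matrix_vector_mult_def sum_distrib_left)
  also have "\<dots> = (\<Sum>j\<in>UNIV. \<Sum>i\<in>UNIV. cnj (u $ i) * (A $ i $ j * v $ j))"
    by (rule sum.swap)
  also have "\<dots> = cinner (dagger A *v u) v"
    by (simp add: cinner_def matrix_vector_mult_def sum_distrib_left sum_distrib_right dagger_nth mult_ac)
  finally show ?thesis .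
qed

lemma matrix_eq_cinnerI:
  assumes "\<And>u v. cinner u (A *v v) = cinner u (B *v v)"
  shows "A = B"
proof -
  have "(A *v v) $ i = (B *v v) $ i" for v i
    using assms[of "axis i 1" v] by (simp add: cinner_axis)
  then show ?thesis
    by (simp add: matrix_eq vec_eq_iff)
qed

lemma psd_imp_hermitian:
  assumes "psd A"
  shows "dagger A = A"
proof (rule matrix_eq_cinnerI)
  fix u v
  have real: "Im (cinner w (A *v w)) = 0" for w
    using assms by (simp add: psd_def complex_nonneg_Reals_iff)
  \<comment> \<open>Polarization: reality of the form at \<open>u + v\<close> relates the imaginary
    parts of the two cross terms, reality at \<open>u + \<i> *s v\<close> the real parts.\<close>
  have "cinner u (A *v v) = cnj (cinner v (A *v u))"
    using real[of "u + v"] real[of "u + \<i> *s v"] real[of u] real[of v]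
    by (simp add: complex_eq_iff cinner_add_left cinner_add_right cinner_scale_left
        cinner_scale_right matrix_vector_right_distrib vector_scalar_commute)
  then show "cinner u (dagger A *v v) = cinner u (A *v v)"
    by (simp add: cinner_dagger[of u "dagger A"] cnj_cinner)
qed

lemma nonneg_Reals_sum: "(\<And>i. i \<in> I \<Longrightarrow> f i \<in> \<real>\<^sub>\<ge>\<^sub>0) \<Longrightarrow> (\<Sum>i\<in>I. f i) \<in> (\<real>\<^sub>\<ge>\<^sub>0 :: complex set)"
  by (induction I rule: infinite_finite_induct) simp_all

text \<open>Hermiticity makes each value of the quadratic form equal to its conjugate, so only the
  sign of its real part remains. Both conditions pass easily to sums and nonnegative
  multiples.\<close>

lemma psd_iff: "psd A \<longleftrightarrow> dagger A = A \<and> (\<forall>v. 0 \<le> Re (cinner v (A *v v)))"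
proof
  assume "psd A"
  then show "dagger A = A \<and> (\<forall>v. 0 \<le> Re (cinner v (A *v v)))"
    by (simp add: psd_imp_hermitian psd_def complex_nonneg_Reals_iff)
next
  assume A: "dagger A = A \<and> (\<forall>v. 0 \<le> Re (cinner v (A *v v)))"
  then have "cnj (cinner v (A *v v)) = cinner v (A *v v)" for v
    by (metis cinner_dagger cnj_cinner)
  then show "psd A"
    using A by (simp add: psd_def complex_nonneg_Reals_iff complex_eq_iff)
qed

lemma scaleR_nth_nth: "(r *\<^sub>R A) $ i $ j = complex_of_real r * A $ i $ j"
  unfolding vector_scaleR_component by (simp add: scaleR_conv_of_real)

lemma psd_nonneg: "psd A \<Longrightarrow> 0 \<le> Re (cinner v (A *v v))"
  by (simp add: psd_iff)

lemma scaleR_matrix_vector: "(r *\<^sub>R A) *v v = complex_of_real r *s (A *v v)"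
  unfolding vec_eq_iff vector_smult_component
  by (simp only: matrix_vector_mult_def vec_lambda_beta scaleR_nth_nth sum_distrib_left mult.assoc) simp

lemma psd_add: "psd A \<Longrightarrow> psd B \<Longrightarrow> psd (A + B)"
  by (simp add: psd_iff dagger_add matrix_vector_mult_add_rdistrib cinner_add_right)

lemma psd_scaleR: "0 \<le> r \<Longrightarrow> psd A \<Longrightarrow> psd (r *\<^sub>R A)"
  by (simp add: psd_iff dagger_scaleR scaleR_matrix_vector cinner_scale_right)

lemma psd_mat_1: "psd (mat 1)"
proof -
  have "dagger (mat 1) = (mat 1 :: 'a op)"
    by (simp add: vec_eq_iff dagger_nth mat_def)
  then show ?thesis
    by (simp add: psd_iff Re_cinner)
qed

lemma trace_add: "trace (A + B) = trace A + trace B"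
  by (simp add: trace_def sum.distrib)

lemma trace_diff: "trace (A - B) = trace A - trace (B :: 'n::finite op)"
  by (simp add: trace_def sum_subtractf)

lemma trace_scaleR: "trace (r *\<^sub>R A) = of_real r * trace (A :: 'n::finite op)"
  by (simp only: trace_def scaleR_nth_nth sum_distrib_left)


section \<open>Spectral decomposition and the trace norm\<close>

definition onb :: "(complex ^ 'n) set \<Rightarrow> bool" where
  "onb B \<longleftrightarrow> finite B \<and> (\<forall>b\<in>B. \<forall>c\<in>B. cinner b c = (if b = c then 1 else 0)) \<and>
     (\<forall>v. (\<Sum>b\<in>B. cinner b v *s b) = v)"

lemma onb_cinner: "onb B \<Longrightarrow> b \<in> B \<Longrightarrow> c \<in> B \<Longrightarrow> cinner b c = (if b = c then 1 else 0)"
  by (simp add: onb_def)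

text \<open>The eigenvector maximizes the Rayleigh quotient on \<open>S\<close>.\<close>

lemma hermitian_eigenvector:
  fixes X :: "'n::finite op"
  assumes X: "dagger X = X"
    and S: "closed S" "\<And>v w. v \<in> S \<Longrightarrow> w \<in> S \<Longrightarrow> v + w \<in> S" "\<And>c v. v \<in> S \<Longrightarrow> c *s v \<in> S"
      "\<And>v. v \<in> S \<Longrightarrow> X *v v \<in> S"
    and u: "u \<in> S" "u \<noteq> 0"
  obtains v l where "v \<in> S" "norm v = 1" "X *v v = complex_of_real l *s v"
proof -
  define q where "q = (\<lambda>v. Re (cinner v (X *v v)))"
  let ?K = "S \<inter> sphere 0 1"
  have comp: "compact ?K"
    using S(1) by (simp add: closed_Int_compact)
  have "(1 / norm u) *\<^sub>R u \<in> ?K"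
    using u S(3)[OF u(1), of "complex_of_real (1 / norm u)"]
    unfolding scaleR_vector_scalar[symmetric] by simp
  then have ne: "?K \<noteq> {}"
    by blast
  have "continuous_on ?K q"
    unfolding q_def cinner_def matrix_vector_mult_def
    by (simp, intro continuous_intros)
  then obtain v where v: "v \<in> ?K" and vmax: "\<And>w. w \<in> ?K \<Longrightarrow> q w \<le> q v"
    using continuous_attains_sup[OF comp ne] by blast
  define l where "l = q v"
  have bound: "q w \<le> l * (norm w)\<^sup>2" if "w \<in> S" for w
  proof (cases "w = 0")
    case False
    define w' where "w' = (1 / norm w) *\<^sub>R w"
    have "w' \<in> ?K"
      using False S(3)[OF that, of "complex_of_real (1 / norm w)"]
      unfolding scaleR_vector_scalar[symmetric] w'_def by simp
    then have "q w' \<le> l"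
      using vmax l_def by simp
    moreover have "q w' = q w / (norm w)\<^sup>2"
      unfolding w'_def q_def scaleR_vector_scalar
      by (simp add: vector_scalar_commute cinner_scale_left cinner_scale_right power2_eq_square)
    ultimately show ?thesis
      using False by (simp add: divide_le_eq)
  qed (simp add: q_def)
  \<comment> \<open>The residual of the eigenvalue equation. It lies in \<open>S\<close>, so
    \<open>v\<close> may be perturbed in its direction.\<close>
  define w where "w = X *v v - complex_of_real l *s v"
  have vS: "v \<in> S" and nv: "norm v = 1"
    using v by auto
  have weq: "w = X *v v + (- complex_of_real l) *s v"
    by (simp add: w_def vec_eq_iff)
  have wS: "w \<in> S"
    unfolding weq by (intro S vS)
  \<comment> \<open>Compare the bound at \<open>v + t w\<close> with its equality at
    \<open>v\<close>: the terms of order zero cancel, and those of order one combine to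
    \<open>2 * t\<close> times the squared norm of \<open>w\<close>.\<close>
  have lin: "2 * t * (norm w)\<^sup>2 \<le> t\<^sup>2 * (l * (norm w)\<^sup>2 - q w)" for t :: real
  proof -
    have "q (v + complex_of_real t *s w) \<le> l * (norm (v + complex_of_real t *s w))\<^sup>2"
      using S vS wS by (intro bound) auto
    moreover have "(norm (v + complex_of_real t *s w))\<^sup>2 =
        1 + 2 * t * Re (cinner w v) + t\<^sup>2 * (norm w)\<^sup>2"
      using nv unfolding scaleR_vector_scalar[symmetric] Re_cinner
      unfolding power2_norm_eq_inner norm_eq_1
      by (simp add: inner_add_left inner_add_right inner_commute power2_eq_square)
    moreover have "cinner v (X *v w) = cinner (X *v v) w"
      using cinner_dagger[of v X w] X by simp
    moreover have "Re (cinner (X *v v) w) = Re (cinner w (X *v v))"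
      by (simp add: Re_cinner inner_commute)
    ultimately have "q v + 2 * t * Re (cinner w (X *v v)) + t\<^sup>2 * q w
        \<le> l * (1 + 2 * t * Re (cinner w v) + t\<^sup>2 * (norm w)\<^sup>2)"
      by (simp add: q_def cinner_add_left cinner_add_right cinner_scale_left cinner_scale_right
          matrix_vector_right_distrib vector_scalar_commute power2_eq_square distrib_left)
    moreover have "(norm w)\<^sup>2 = Re (cinner w (X *v v)) - l * Re (cinner w v)"
      unfolding power2_norm_eq_inner Re_cinner[symmetric]
      by (subst (2) w_def) (simp add: cinner_diff_right cinner_scale_right)
    then have "Re (cinner w (X *v v)) = (norm w)\<^sup>2 + l * Re (cinner w v)"
      by simp
    ultimately show ?thesis
      unfolding l_def[symmetric] by (simp add: algebra_simps)
  qed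
  have "(norm w)\<^sup>2 = 0"
  proof (rule ccontr)
    assume "(norm w)\<^sup>2 \<noteq> 0"
    then have N: "(norm w)\<^sup>2 > 0"
      by simp
    define M where "M = l * (norm w)\<^sup>2 - q w"
    have "M \<ge> 0"
      using bound[OF wS] by (simp add: M_def)
    \<comment> \<open>A quadratic term cannot dominate a linear one for small \<open>t\<close>. With
      this choice \<open>t * (M + 1)\<close> is exactly the squared norm of \<open>w\<close>; the
      \<open>+ 1\<close> keeps the denominator positive when \<open>M = 0\<close>.\<close>
    define t where "t = (norm w)\<^sup>2 / (M + 1)"
    have t: "t > 0"
      using N \<open>M \<ge> 0\<close> by (simp add: t_def)
    have "2 * t * (norm w)\<^sup>2 \<le> t\<^sup>2 * M"
      using lin by (simp add: M_def)
    then have "2 * (norm w)\<^sup>2 \<le> t * M"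
      using t by (simp add: power2_eq_square)
    also have "t * M \<le> t * (M + 1)"
      using t by simp
    also have "\<dots> = (norm w)\<^sup>2"
      using \<open>M \<ge> 0\<close> by (simp add: t_def)
    finally show False
      using N by simp
  qed
  then have "X *v v = complex_of_real l *s v"
    by (simp add: w_def)
  with vS nv show thesis
    by (rule that)
qed

text \<open>An orthonormal family of eigenvectors of largest cardinality is complete: its orthogonal
  complement is closed and invariant under \<open>X\<close>, so a nonzero complement would supply
  one more eigenvector.\<close>

theorem hermitian_eigenbasis:
  fixes X :: "'n::finite op"
  assumes X: "dagger X = X"
  obtains B l where "onb B" "\<And>b. b \<in> B \<Longrightarrow> X *v b = complex_of_real (l b) *s b"
proof -
  define P where "P = (\<lambda>B. finite B \<and> (\<forall>b\<in>B. \<forall>c\<in>B. cinner b c = (if b = c then 1 else 0)) \<and>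
     (\<forall>b\<in>B. \<exists>l. X *v b = complex_of_real l *s b))"
  \<comment> \<open>Complex orthogonality implies orthogonality for the real inner product, so the
    real dimension is a bound. Any finite bound yields a family of largest cardinality.\<close>
  have card: "card B \<le> DIM(complex ^ 'n)" if "P B" for B
  proof -
    have "pairwise orthogonal B"
      using that by (auto simp: P_def pairwise_def orthogonal_def Re_cinner[symmetric])
    moreover have "0 \<notin> B"
      using that by (force simp: P_def)
    ultimately show ?thesis
      using pairwise_orthogonal_independent independent_bound by blast
  qed
  have "P {}"
    by (simp add: P_def)
  then obtain B where PB: "P B" and max: "\<And>C. P C \<Longrightarrow> card C \<le> card B"
    using ex_has_greatest_nat[of P "{}" card "Suc (DIM(complex ^ 'n))"] card
    by (metis le_imp_less_Suc)
  then have fin: "finite B"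
    and orth: "\<And>b c. b \<in> B \<Longrightarrow> c \<in> B \<Longrightarrow> cinner b c = (if b = c then 1 else 0)"
    and "\<forall>b\<in>B. \<exists>l. X *v b = complex_of_real l *s b"
    by (auto simp: P_def)
  then obtain l where l: "\<And>b. b \<in> B \<Longrightarrow> X *v b = complex_of_real (l b) *s b"
    by metis
  define S where "S = {v. \<forall>b\<in>B. cinner b v = 0}"
  have "S = (\<Inter>b\<in>B. {v. cinner b v = 0})"
    by (auto simp: S_def)
  moreover have "closed {v. cinner b v = 0}" for b
    unfolding cinner_def by (intro closed_Collect_eq continuous_intros)
  ultimately have "closed S"
    by auto
  have S0: "S \<subseteq> {0}"
  proof (rule ccontr)
    assume "\<not> S \<subseteq> {0}"
    then obtain u where u: "u \<in> S" "u \<noteq> 0"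
      by auto
    have inv: "X *v v \<in> S" if "v \<in> S" for v
      using that by (auto simp: S_def cinner_dagger X l cinner_scale_left)
    obtain v k where v: "v \<in> S" "norm v = 1" "X *v v = complex_of_real k *s v"
      by (rule hermitian_eigenvector[OF X \<open>closed S\<close> _ _ inv u])
        (auto simp: S_def cinner_add_right cinner_scale_right)
    have "v \<notin> B"
      using v orth by (auto simp: S_def)
    have "cinner b v = 0" "cinner v b = 0" if "b \<in> B" for b
      using v that cnj_cinner[of b v] by (auto simp: S_def)
    then have "P (insert v B)"
      using PB v \<open>v \<notin> B\<close> by (auto simp: P_def cinner_self)
    from max[OF this] show False
      using fin \<open>v \<notin> B\<close> by simp
  qed
  have "(\<Sum>b\<in>B. cinner b v *s b) = v" for v
  proof -
    \<comment> \<open>What remains of \<open>v\<close> after its expansion is orthogonal to all of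
      \<open>B\<close>, hence lies in \<open>S\<close>, which contains no nonzero vector.\<close>
    have "cinner c (v - (\<Sum>b\<in>B. cinner b v *s b)) = 0" if c: "c \<in> B" for c
    proof -
      have "(\<Sum>b\<in>B. cinner b v * cinner c b) = (\<Sum>b\<in>B. if b = c then cinner c v else 0)"
        using c orth[OF c] by (intro sum.cong) simp_all
      then show ?thesis
        using fin c by (simp add: cinner_diff_right cinner_sum_right cinner_scale_right)
    qed
    then have "v - (\<Sum>b\<in>B. cinner b v *s b) \<in> S"
      by (simp add: S_def)
    then show ?thesis
      using S0 by auto
  qed
  with fin orth have "onb B"
    by (simp add: onb_def)
  then show thesis
    using l that by blast
qed

section \<open>Computing in an orthonormal basis\<close>

lemma matrix_vector_mult_sum: "A *v (\<Sum>b\<in>B. f b) = (\<Sum>b\<in>B. A *v f b)"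
  for A :: "'n::finite op"
  by (induction B rule: infinite_finite_induct) (simp_all add: matrix_vector_right_distrib)

lemma onb_matrix_eqI:
  fixes A C :: "'n::finite op"
  assumes "onb B" and eq: "\<And>b. b \<in> B \<Longrightarrow> A *v b = C *v b"
  shows "A = C"
proof -
  have "A *v v = C *v v" for v
  proof -
    have v: "v = (\<Sum>b\<in>B. cinner b v *s b)"
      using assms(1) by (simp add: onb_def)
    show ?thesis
      by (subst (1 2) v) (simp add: matrix_vector_mult_sum vector_scalar_commute eq)
  qed
  then show ?thesis
    by (simp add: matrix_eq)
qed

lemma onb_trace:
  fixes A :: "'n::finite op"
  assumes "onb B"
  shows "trace A = (\<Sum>b\<in>B. cinner b (A *v b))"
proof -
  \<comment> \<open>The completeness relation in matrix entries: component \<open>j\<close> of the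
    expansion of \<open>axis i 1\<close>.\<close>
  have delta: "(\<Sum>b\<in>B. b $ j * cnj (b $ i)) = (if i = j then 1 else 0)" for i j
  proof -
    have "(\<Sum>b\<in>B. cinner b (axis i 1) *s b) $ j = (axis i 1 :: complex ^ 'n) $ j"
      using assms by (simp add: onb_def)
    moreover have "cinner b (axis i 1) = cnj (b $ i)" for b :: "complex ^ 'n"
      using cnj_cinner[of "axis i 1" b] by (simp add: cinner_axis)
    ultimately show ?thesis
      by (auto simp: axis_def mult.commute)
  qed
  have "(\<Sum>b\<in>B. cinner b (A *v b)) = (\<Sum>b\<in>B. \<Sum>i\<in>UNIV. \<Sum>j\<in>UNIV. A $ i $ j * (b $ j * cnj (b $ i)))"
    by (simp add: cinner_def matrix_vector_mult_def sum_distrib_left mult_ac)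
  also have "\<dots> = (\<Sum>i\<in>UNIV. \<Sum>j\<in>UNIV. \<Sum>b\<in>B. A $ i $ j * (b $ j * cnj (b $ i)))"
    by (simp add: sum.swap[of _ B])
  also have "\<dots> = (\<Sum>i\<in>UNIV. \<Sum>j\<in>UNIV. A $ i $ j * (if i = j then 1 else 0))"
    by (simp add: delta flip: sum_distrib_left)
  also have "\<dots> = trace A"
    by (simp add: trace_def if_distrib cong: if_cong)
  finally show ?thesis ..
qed

text \<open>The weighted sum of the rank-one operators |b><b|. An orthonormal basis \<open>B\<close>
  gives a diagonal operator with eigenvalues \<open>f b\<close>; a singleton gives the rank-one
  operator from which the Choi matrix is built.\<close>

definition spectral_op :: "(complex ^ 'n::finite) set \<Rightarrow> (complex ^ 'n \<Rightarrow> real) \<Rightarrow> 'n op" where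
  "spectral_op B f = (\<chi> i j. \<Sum>b\<in>B. of_real (f b) * (b $ i * cnj (b $ j)))"

lemma dagger_spectral_op [simp]: "dagger (spectral_op B f) = spectral_op B f"
  by (simp add: vec_eq_iff dagger_nth spectral_op_def mult_ac)

lemma spectral_op_diff: "spectral_op B (\<lambda>b. f b - g b) = spectral_op B f - spectral_op B g"
  by (simp add: vec_eq_iff spectral_op_def algebra_simps sum_subtractf)

lemma spectral_op_mult: "spectral_op B f *v v = (\<Sum>b\<in>B. (of_real (f b) * cinner b v) *s b)"
proof -
  have "(spectral_op B f *v v) $ i = (\<Sum>b\<in>B. (of_real (f b) * cinner b v) *s b) $ i" for i
  proof -
    have "(spectral_op B f *v v) $ i = (\<Sum>j\<in>UNIV. \<Sum>b\<in>B. of_real (f b) * (b $ i * cnj (b $ j)) * v $ j)"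
      by (simp add: spectral_op_def matrix_vector_mult_def sum_distrib_right)
    also have "\<dots> = (\<Sum>b\<in>B. \<Sum>j\<in>UNIV. of_real (f b) * (b $ i * cnj (b $ j)) * v $ j)"
      by (rule sum.swap)
    finally show ?thesis
      by (simp add: cinner_def sum_distrib_left sum_distrib_right mult_ac)
  qed
  then show ?thesis
    by (simp add: vec_eq_iff)
qed

lemma cinner_spectral_op:
  "cinner u (spectral_op B f *v v) = (\<Sum>b\<in>B. of_real (f b) * (cinner u b * cinner b v))"
  by (simp add: spectral_op_mult cinner_sum_right cinner_scale_right mult_ac)

lemma spectral_op_eigen:
  assumes "onb B" "b \<in> B"
  shows "spectral_op B f *v b = of_real (f b) *s b"
proof -
  have "spectral_op B f *v b = (\<Sum>c\<in>B. if c = b then of_real (f b) *s b else 0)"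
    unfolding spectral_op_mult using assms by (intro sum.cong) (simp_all add: onb_cinner)
  then show ?thesis
    using assms by (simp add: onb_def)
qed

lemma psd_spectral_op:
  assumes "\<And>b. b \<in> B \<Longrightarrow> 0 \<le> f b"
  shows "psd (spectral_op B f)"
proof -
  have "0 \<le> Re (of_real (f b) * (cinner v b * cinner b v))" if "b \<in> B" for b v
  proof -
    have "cinner v b * cinner b v = of_real ((cmod (cinner b v))\<^sup>2)"
      using complex_norm_square[of "cinner b v"] by (simp add: cnj_cinner mult.commute)
    then show ?thesis
      using assms[OF that] by simp
  qed
  then show ?thesis
    by (simp add: psd_iff cinner_spectral_op sum_nonneg)
qed

lemma trace_spectral_op: "onb B \<Longrightarrow> trace (spectral_op B f) = of_real (\<Sum>b\<in>B. f b)"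
  by (simp add: onb_trace spectral_op_eigen cinner_scale_right onb_cinner)

lemma spectral_decomposition:
  fixes X :: "'n::finite op"
  assumes "dagger X = X"
  obtains B l where "onb B" "X = spectral_op B l"
proof -
  obtain B l where B: "onb B" "\<And>b. b \<in> B \<Longrightarrow> X *v b = complex_of_real (l b) *s b"
    using hermitian_eigenbasis[OF assms] by metis
  then have "X = spectral_op B l"
    using onb_matrix_eqI[OF B(1)] by (simp add: spectral_op_eigen)
  with B(1) show thesis
    by (rule that)
qed

lemma psd_spectral_decomposition:
  assumes "psd X"
  obtains B l where "onb B" "X = spectral_op B l" "\<And>b. b \<in> B \<Longrightarrow> 0 \<le> l b"
proof -
  obtain B l where B: "onb B" "X = spectral_op B l"
    using spectral_decomposition[OF psd_imp_hermitian[OF assms]] by metis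
  moreover have "0 \<le> l b" if "b \<in> B" for b
    using psd_nonneg[OF assms, of b] B that
    by (simp add: spectral_op_eigen cinner_scale_right onb_cinner)
  ultimately show thesis
    by (rule that)
qed

lemma psd_trace_nonneg:
  assumes "psd A"
  shows "0 \<le> Re (trace A)"
proof -
  obtain B l where "onb B" "A = spectral_op B l" "\<And>b. b \<in> B \<Longrightarrow> 0 \<le> l b"
    using psd_spectral_decomposition[OF assms] by metis
  then show ?thesis
    by (simp add: trace_spectral_op sum_nonneg)
qed

lemma psd_trace_real: "psd A \<Longrightarrow> trace A = of_real (Re (trace A))"
  by (metis Re_complex_of_real psd_imp_hermitian spectral_decomposition trace_spectral_op)

lemma psd_trace_0:
  assumes "psd A" "Re (trace A) \<le> 0"
  shows "A = 0"
proof -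
  obtain B l where B: "onb B" "A = spectral_op B l" "\<And>b. b \<in> B \<Longrightarrow> 0 \<le> l b"
    using psd_spectral_decomposition[OF assms(1)] by metis
  then have "(\<Sum>b\<in>B. l b) = 0"
    using assms(2) sum_nonneg[of B l] by (simp add: trace_spectral_op)
  then have "\<forall>b\<in>B. l b = 0"
    using B sum_nonneg_eq_0_iff[of B l] by (auto simp: onb_def)
  then show ?thesis
    using B by (simp add: spectral_op_def vec_eq_iff)
qed

section \<open>Square roots, the trace norm and positivity\<close>

text \<open>On an eigenvector \<open>b\<close> of \<open>R\<close> with eigenvalue r, (S + r)(S - r)
  b = 0. So w = (S - r) b satisfies S w = -r w, which positivity of \<open>S\<close> allows for r >
  0 only if w = 0. For r = 0 the squared norm of S b is <b, S S b> = 0.\<close>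

lemma psd_sqrt_unique:
  fixes R S :: "'n::finite op"
  assumes R: "psd R" and S: "psd S" and eq: "R ** R = S ** S"
  shows "R = S"
proof -
  obtain B r where B: "onb B" "R = spectral_op B r" "\<And>b. b \<in> B \<Longrightarrow> 0 \<le> r b"
    using psd_spectral_decomposition[OF R] by metis
  have "R *v b = S *v b" if b: "b \<in> B" for b
  proof -
    have Rb: "R *v b = of_real (r b) *s b"
      using B b by (simp add: spectral_op_eigen)
    have SSb: "S *v (S *v b) = of_real (r b * r b) *s b"
      using arg_cong[OF eq, of "\<lambda>M. M *v b"]
      by (simp add: Rb vector_scalar_commute flip: matrix_vector_mul_assoc)
    define w where "w = S *v b - of_real (r b) *s b"
    have Sw: "S *v w = - of_real (r b) *s w"
      by (simp add: w_def matrix_vector_mult_diff_distrib vector_scalar_commute SSb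
          vec_eq_iff algebra_simps)
    have "w = 0"
    proof (cases "r b = 0")
      case True
      have "cinner (S *v b) (S *v b) = cinner b (S *v (S *v b))"
        using psd_imp_hermitian[OF S] by (simp add: cinner_dagger[of b S])
      then show ?thesis
        using True SSb by (simp add: w_def)
    next
      case False
      have "0 \<le> - r b * (norm w)\<^sup>2"
        using psd_nonneg[OF S, of w] unfolding Sw cinner_scale_right by (simp add: cinner_self)
      then show ?thesis
        using False B(3)[OF b] by (simp add: mult_le_0_iff)
    qed
    then show ?thesis
      by (simp add: w_def Rb)
  qed
  then show ?thesis
    using onb_matrix_eqI[OF B(1)] by blast
qed

text \<open>Uniqueness of the positive root resolves the definite description in
  \<open>psd_sqrt\<close>, so exhibiting one positive root is enough.\<close>

lemma trace_norm_eqI: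
  assumes "psd R" "R ** R = dagger A ** A"
  shows "trace_norm A = Re (trace R)"
proof -
  have "psd_sqrt (dagger A ** A) = R"
    unfolding psd_sqrt_def using assms by (intro the_equality) (auto intro: psd_sqrt_unique)
  then show ?thesis
    by (simp add: trace_norm_def)
qed

lemma trace_norm_psd: "psd A \<Longrightarrow> trace_norm A = Re (trace A)"
  using psd_imp_hermitian trace_norm_eqI by metis

lemma trace_norm_spectral_op:
  assumes "onb B"
  shows "trace_norm (spectral_op B l) = (\<Sum>b\<in>B. \<bar>l b\<bar>)"
proof -
  let ?R = "spectral_op B (\<lambda>b. \<bar>l b\<bar>)"
  have "?R ** ?R = spectral_op B l ** spectral_op B l"
    by (rule onb_matrix_eqI[OF assms])
      (simp add: assms spectral_op_eigen vector_scalar_commute flip: matrix_vector_mul_assoc of_real_mult)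
  then have "trace_norm (spectral_op B l) = Re (trace ?R)"
    by (intro trace_norm_eqI psd_spectral_op) auto
  then show ?thesis
    by (simp add: trace_spectral_op[OF assms])
qed

lemma trace_norm_nonneg:
  assumes "dagger X = X"
  shows "0 \<le> trace_norm X"
  by (metis assms spectral_decomposition trace_norm_spectral_op sum_nonneg abs_ge_zero)

text \<open>In an eigenbasis of \<open>P - Q\<close> each eigenvalue is a difference of diagonal
  entries of \<open>P\<close> and \<open>Q\<close>, both nonnegative, so its absolute value is at
  most their sum. Summing gives the traces.\<close>

lemma trace_norm_diff_le:
  assumes P: "psd P" and Q: "psd Q"
  shows "trace_norm (P - Q) \<le> Re (trace P) + Re (trace Q)"
proof -
  obtain B l where B: "onb B" "P - Q = spectral_op B l"
    using spectral_decomposition[of "P - Q"] P Q by (auto simp: dagger_diff psd_imp_hermitian)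
  have "\<bar>l b\<bar> \<le> Re (cinner b (P *v b)) + Re (cinner b (Q *v b))" if "b \<in> B" for b
  proof -
    have "cinner b ((P - Q) *v b) = of_real (l b)"
      using B that by (simp add: spectral_op_eigen cinner_scale_right onb_cinner)
    then have "l b = Re (cinner b (P *v b)) - Re (cinner b (Q *v b))"
      by (simp add: matrix_vector_mult_diff_rdistrib cinner_diff_right complex_eq_iff)
    then show ?thesis
      using psd_nonneg[OF P, of b] psd_nonneg[OF Q, of b] by linarith
  qed
  then have "trace_norm (P - Q) \<le> (\<Sum>b\<in>B. Re (cinner b (P *v b)) + Re (cinner b (Q *v b)))"
    using B by (simp add: trace_norm_spectral_op sum_mono)
  then show ?thesis
    by (simp add: onb_trace[OF B(1)] sum.distrib)
qed

text \<open>Split the eigenvalues into positive and negative parts. This choice attains equality in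
  \<open>trace_norm_diff_le\<close>, which is what makes the contraction and positivity criteria
  below work.\<close>

lemma jordan_decomposition:
  assumes "dagger X = X"
  obtains P Q where "psd P" "psd Q" "X = P - Q" "trace_norm X = Re (trace P) + Re (trace Q)"
proof -
  obtain B l where B: "onb B" "X = spectral_op B l"
    using spectral_decomposition[OF assms] by metis
  let ?P = "spectral_op B (\<lambda>b. max (l b) 0)" and ?Q = "spectral_op B (\<lambda>b. max (- l b) 0)"
  have "psd ?P" "psd ?Q"
    by (auto intro: psd_spectral_op)
  moreover have "(\<lambda>b. max (l b) 0 - max (- l b) 0) = l"
    by auto
  then have "X = ?P - ?Q"
    using B by (simp flip: spectral_op_diff)
  moreover have "\<bar>l b\<bar> = max (l b) 0 + max (- l b) 0" for b
    by auto
  then have "trace_norm X = Re (trace ?P) + Re (trace ?Q)"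
    using B by (simp add: trace_norm_spectral_op trace_spectral_op sum.distrib)
  ultimately show thesis
    by (rule that)
qed

text \<open>The trace norm adds the traces of the Jordan parts while the trace subtracts them, so
  the negative part has trace at most zero and vanishes.\<close>

lemma psd_if_trace_norm_le_trace:
  assumes "dagger X = X" "trace_norm X \<le> Re (trace X)"
  shows "psd X"
proof -
  obtain P Q where PQ: "psd P" "psd Q" "X = P - Q" "trace_norm X = Re (trace P) + Re (trace Q)"
    using jordan_decomposition[OF assms(1)] by metis
  then have "Re (trace Q) \<le> 0"
    using assms(2) by (simp add: trace_diff)
  then show ?thesis
    using PQ psd_trace_0 by fastforce
qed


section \<open>Positive maps\<close>

definition positive_map :: "('n::finite op \<Rightarrow> 'm::finite op) \<Rightarrow> bool" where
  "positive_map T \<longleftrightarrow> op_linear T \<and> (\<forall>A. psd A \<longrightarrow> psd (T A))"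

lemma op_linear_add: "op_linear T \<Longrightarrow> T (A + B) = T A + T B"
  by (simp add: op_linear_iff)

lemma op_linear_cscale: "op_linear T \<Longrightarrow> T (cscale c A) = cscale c (T A)"
  by (simp add: op_linear_iff)

lemma cscale_of_real: "cscale (of_real r) A = r *\<^sub>R A"
  unfolding vec_eq_iff cscale_nth vector_scaleR_component by (simp add: scaleR_conv_of_real)

lemma op_linear_scaleR: "op_linear T \<Longrightarrow> T (r *\<^sub>R A) = r *\<^sub>R T A"
  by (simp add: op_linear_cscale flip: cscale_of_real)

lemma op_linear_diff:
  assumes "op_linear T"
  shows "T (A - B) = T A - T B"
  using op_linear_add[OF assms, of "A - B" B] by simp

lemma op_linear_zero: "op_linear T \<Longrightarrow> T 0 = 0"
  using op_linear_diff[of T 0 0] by simp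

lemma op_linear_sum: "op_linear T \<Longrightarrow> T (\<Sum>i\<in>I. f i) = (\<Sum>i\<in>I. T (f i))"
  by (induction I rule: infinite_finite_induct) (simp_all add: op_linear_add op_linear_zero)

lemma op_linear_compose: "op_linear S \<Longrightarrow> op_linear T \<Longrightarrow> op_linear (S \<circ> T)"
  by (simp add: op_linear_iff)

lemma positive_map_hermitian:
  assumes T: "positive_map T" and X: "dagger X = X"
  shows "dagger (T X) = T X"
proof -
  obtain P Q where "psd P" "psd Q" "X = P - Q"
    using jordan_decomposition[OF X] by metis
  then show ?thesis
    using T by (simp add: positive_map_def op_linear_diff dagger_diff psd_imp_hermitian)
qed

lemma positive_map_dagger:
  assumes T: "positive_map T"
  shows "T (dagger A) = dagger (T A)"
proof -
  \<comment> \<open>Cartesian decomposition \<open>A = H + \<i> K\<close> with Hermitian parts, on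
    which the adjoint only flips the sign of \<open>\<i>\<close>.\<close>
  define H where "H = (1/2) *\<^sub>R (A + dagger A)"
  define K where "K = cscale (- \<i> / 2) (A - dagger A)"
  have "dagger H = H" "dagger K = K"
    by (simp_all add: H_def K_def vec_eq_iff dagger_nth cscale_nth scaleR_nth_nth algebra_simps
        del: vector_scaleR_component)
  then have HK: "dagger (T H) = T H" "dagger (T K) = T K"
    using positive_map_hermitian[OF T] by blast+
  have "A = H + cscale \<i> K" "dagger A = H + cscale (- \<i>) K"
    by (simp_all add: H_def K_def vec_eq_iff dagger_nth cscale_nth scaleR_nth_nth field_simps
        del: vector_scaleR_component)
  moreover have "op_linear T"
    using T by (simp add: positive_map_def)
  ultimately have "T A = T H + cscale \<i> (T K)" "T (dagger A) = T H + cscale (- \<i>) (T K)"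
    by (simp_all only: op_linear_add op_linear_cscale)
  then show ?thesis
    by (simp add: dagger_add dagger_cscale HK)
qed

lemma positive_map_density:
  assumes "positive_map T" "trace_preserving T" "\<rho> \<in> density"
  shows "T \<rho> \<in> density"
  using assms by (simp add: positive_map_def trace_preserving_def density_def)

text \<open>The images of the Jordan parts stay positive and keep their traces. They need no longer
  be the Jordan parts of the image, whence only an inequality.\<close>

lemma trace_norm_contract:
  assumes T: "positive_map T" "trace_preserving T" and X: "dagger X = X"
  shows "trace_norm (T X) \<le> trace_norm X"
proof -
  obtain P Q where "psd P" "psd Q" "X = P - Q" "trace_norm X = Re (trace P) + Re (trace Q)"
    using jordan_decomposition[OF X] by metis
  then show ?thesis
    using T trace_norm_diff_le[of "T P" "T Q"]
    by (simp add: positive_map_def op_linear_diff trace_preserving_def)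
qed


section \<open>Tensoring with the identity\<close>

text \<open>\<open>block\<close> and \<open>slice\<close> fix the ancilla indices. They translate
  between operators indexed by pairs and the arrays of \<open>psd_blocks\<close>.\<close>

definition block :: "('s::finite \<times> 'a::finite) op \<Rightarrow> 'a \<Rightarrow> 'a \<Rightarrow> 's op" where
  "block X a b = (\<chi> i j. X $ (i, a) $ (j, b))"

definition slice :: "complex ^ ('s::finite \<times> 'a::finite) \<Rightarrow> 'a \<Rightarrow> complex ^ 's" where
  "slice v a = (\<chi> i. v $ (i, a))"

lemma block_tensor_id [simp]: "block (tensor_id T X) a b = T (block X a b)"
  by (simp add: block_def tensor_id_def)

lemma block_eqI:
  assumes "\<And>a b. block X a b = block Y a b"
  shows "X = Y"
  using assms by (simp add: block_def vec_eq_iff)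

lemma tensor_id_compose: "tensor_id (S \<circ> T) = tensor_id S \<circ> tensor_id T"
  by (intro ext block_eqI) simp

lemma tensor_id_id: "tensor_id id = id"
  by (intro ext block_eqI) simp

lemma sum_UNIV_prod: "(\<Sum>p\<in>UNIV. f p) = (\<Sum>a\<in>UNIV. \<Sum>i\<in>UNIV. f (i, a))"
  for f :: "'s::finite \<times> 'a::finite \<Rightarrow> 'b::comm_monoid_add"
proof -
  have "(\<Sum>p\<in>UNIV. f p) = (\<Sum>i\<in>UNIV. \<Sum>a\<in>UNIV. f (i, a))"
    by (simp add: sum.cartesian_product UNIV_Times_UNIV)
  then show ?thesis
    by (simp add: sum.swap[of _ "UNIV :: 's set"])
qed

lemma trace_block: "trace X = (\<Sum>a\<in>UNIV. trace (block X a a))"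
  by (simp add: trace_def sum_UNIV_prod block_def)

lemma trace_preserving_tensor_id: "trace_preserving T \<Longrightarrow> trace_preserving (tensor_id T)"
  by (simp add: trace_preserving_def trace_block[of "tensor_id T _"]) (simp add: trace_block)

lemma cinner_block:
  "cinner v (X *v w) = (\<Sum>a\<in>UNIV. \<Sum>b\<in>UNIV. cinner (slice v a) (block X a b *v slice w b))"
proof -
  have "cinner v (X *v w) = (\<Sum>a\<in>UNIV. \<Sum>i\<in>UNIV. \<Sum>b\<in>UNIV. \<Sum>j\<in>UNIV.
      cnj (v $ (i, a)) * (X $ (i, a) $ (j, b) * w $ (j, b)))"
    by (simp add: cinner_def matrix_vector_mult_def sum_UNIV_prod sum_distrib_left)
  also have "\<dots> = (\<Sum>a\<in>UNIV. \<Sum>b\<in>UNIV. \<Sum>i\<in>UNIV. \<Sum>j\<in>UNIV.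
      cnj (v $ (i, a)) * (X $ (i, a) $ (j, b) * w $ (j, b)))"
    by (intro sum.cong refl) (rule sum.swap)
  finally show ?thesis
    by (simp add: cinner_def matrix_vector_mult_def slice_def block_def sum_distrib_left)
qed

lemma psd_blocks_block:
  fixes X :: "('s::finite \<times> 'a::finite) op"
  assumes e: "bij_betw e {..<k} (UNIV :: 'a set)"
  shows "psd_blocks k (\<lambda>a b. block X (e a) (e b)) \<longleftrightarrow> psd X"
proof -
  have sum_e: "(\<Sum>a<k. f (e a)) = (\<Sum>a\<in>UNIV. f a)" for f :: "'a \<Rightarrow> complex"
    using sum.reindex_bij_betw[OF e] .
  have main: "cinner u (X *v u) =
      (\<Sum>a<k. \<Sum>b<k. cinner (slice u (e a)) (block X (e a) (e b) *v slice u (e b)))" for u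
    by (simp add: cinner_block sum_e[of "\<lambda>b. cinner _ (block X _ b *v slice u b)"]
        sum_e[of "\<lambda>a. \<Sum>b\<in>UNIV. cinner (slice u a) (block X a b *v slice u b)"])
  show ?thesis
  proof
    assume "psd_blocks k (\<lambda>a b. block X (e a) (e b))"
    then show "psd X"
      by (simp add: psd_blocks_def psd_def main)
  next
    assume X: "psd X"
    show "psd_blocks k (\<lambda>a b. block X (e a) (e b))"
      unfolding psd_blocks_def
    proof
      fix v :: "nat \<Rightarrow> complex ^ 's"
      \<comment> \<open>Glue the family \<open>v\<close> into one vector, with the inverse of
        \<open>e\<close> numbering the ancilla basis.\<close>
      define u where "u = (\<chi> p. v (the_inv_into {..<k} e (snd p)) $ fst p)"
      have "slice u (e a) = v a" if "a < k" for a
        using e that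
        by (simp add: u_def slice_def vec_eq_iff the_inv_into_f_f bij_betw_def)
      then have "cinner u (X *v u) = (\<Sum>a<k. \<Sum>b<k. cinner (v a) (block X (e a) (e b) *v v b))"
        by (simp add: main)
      then show "(\<Sum>a<k. \<Sum>b<k. cinner (v a) (block X (e a) (e b) *v v b)) \<in> \<real>\<^sub>\<ge>\<^sub>0"
        using X by (metis psd_def)
    qed
  qed
qed

text \<open>Complete positivity is used at the array size \<open>CARD('a)\<close>, after numbering
  the ancilla basis.\<close>

lemma completely_positive_tensor_id:
  fixes T :: "'s::finite op \<Rightarrow> 's op"
  assumes T: "op_linear T" "completely_positive T"
  shows "positive_map (tensor_id T :: ('s \<times> 'a::finite) op \<Rightarrow> _)"
proof -
  obtain e where e: "bij_betw e {..<CARD('a)} (UNIV :: 'a set)"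
    using ex_bij_betw_nat_finite[of "UNIV :: 'a set"] by (auto simp: atLeast0LessThan)
  have "psd (tensor_id T X)" if "psd X" for X :: "('s \<times> 'a) op"
    using that T(2) unfolding psd_blocks_block[OF e, symmetric]
    by (simp add: completely_positive_def)
  then show ?thesis
    by (simp add: positive_map_def op_linear_tensor_id T(1))
qed

lemma completely_positive_positive_map:
  fixes T :: "'n::finite op \<Rightarrow> 'm::finite op"
  assumes T: "op_linear T" "completely_positive T"
  shows "positive_map T"
proof -
  have psd_blocks_1: "psd_blocks 1 (\<lambda>_ _. X) \<longleftrightarrow> psd X" for X :: "'k::finite op"
    by (auto simp: psd_blocks_def psd_def dest: spec[of _ "\<lambda>_. _"])
  have "psd (T X)" if "psd X" for X
  proof -
    have "psd_blocks 1 (\<lambda>_ _. X)"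
      using that by (simp only: psd_blocks_1)
    with T(2) have "psd_blocks 1 (\<lambda>_ _. T X)"
      unfolding completely_positive_def by blast
    then show ?thesis
      by (simp only: psd_blocks_1)
  qed
  then show ?thesis
    by (simp add: positive_map_def T(1))
qed

section \<open>Choi's theorem\<close>

definition matrix_unit :: "'n \<Rightarrow> 'n \<Rightarrow> 'n::finite op" where
  "matrix_unit a b = (\<chi> i j. if i = a \<and> j = b then 1 else 0)"

lemma matrix_unit_expansion: "X = (\<Sum>a\<in>UNIV. \<Sum>b\<in>UNIV. cscale (X $ a $ b) (matrix_unit a b))"
proof -
  have "(\<Sum>a\<in>UNIV. \<Sum>b\<in>UNIV. X $ a $ b * (if i = a \<and> j = b then 1 else 0)) = X $ i $ j" for i j
  proof -
    have "(\<Sum>b\<in>UNIV. X $ a $ b * (if i = a \<and> j = b then 1 else 0)) = (if a = i then X $ a $ j else 0)" for a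
      by (simp add: if_distrib cong: if_cong)
    then show ?thesis
      by simp
  qed
  then show ?thesis
    by (simp add: vec_eq_iff cscale_nth matrix_unit_def)
qed

text \<open>
  The eigenvectors of the Choi matrix \<open>C\<close>, reshaped to matrices, are Kraus operators of \<open>T\<close>, up to
  the square roots of the eigenvalues.
\<close>

lemma choi:
  fixes T :: "'s::finite op \<Rightarrow> 's op" and f :: "'s \<Rightarrow> 'a::finite"
  assumes lin: "op_linear T" and f: "bij f"
    and pos: "\<And>X :: ('s \<times> 'a) op. psd X \<Longrightarrow> psd (tensor_id T X)"
  shows "completely_positive T"
proof -
  \<comment> \<open>The unnormalized maximally entangled vector; \<open>f\<close> matches the system
    basis with the ancilla basis.\<close>
  define \<omega> :: "complex ^ ('s \<times> 'a)" where "\<omega> = (\<chi> p. if snd p = f (fst p) then 1 else 0)"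
  define C where "C = tensor_id T (spectral_op {\<omega>} (\<lambda>_. 1))"
  have "psd C"
    unfolding C_def by (intro pos psd_spectral_op) simp
  then obtain B l where B: "C = spectral_op B l" and l: "\<And>c. c \<in> B \<Longrightarrow> 0 \<le> l c"
    using psd_spectral_decomposition by metis
  \<comment> \<open>The blocks of |\<omega>><\<omega>| are the matrix units, so those of
    \<open>C\<close> are their images and determine \<open>T\<close>.\<close>
  have "block (spectral_op {\<omega>} (\<lambda>_. 1)) (f a) (f b) = matrix_unit a b" for a b
    using f by (auto simp: block_def spectral_op_def \<omega>_def matrix_unit_def vec_eq_iff bij_def inj_eq)
  then have "block C (f a) (f b) = T (matrix_unit a b)" for a b
    by (simp add: C_def)
  then have T_unit: "T (matrix_unit a b) $ i $ j =
      (\<Sum>c\<in>B. of_real (l c) * (c $ (i, f a) * cnj (c $ (j, f b))))" for a b i j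
    by (simp add: B block_def spectral_op_def vec_eq_iff)
  have T_nth: "T X $ i $ j = (\<Sum>c\<in>B. \<Sum>a\<in>UNIV. \<Sum>b\<in>UNIV.
      of_real (l c) * (X $ a $ b * (c $ (i, f a) * cnj (c $ (j, f b)))))" for X i j
  proof -
    have "T X = (\<Sum>a\<in>UNIV. \<Sum>b\<in>UNIV. cscale (X $ a $ b) (T (matrix_unit a b)))"
      by (subst matrix_unit_expansion[of X]) (simp add: op_linear_sum[OF lin] op_linear_cscale[OF lin])
    then have "T X $ i $ j = (\<Sum>a\<in>UNIV. \<Sum>b\<in>UNIV. \<Sum>c\<in>B.
        of_real (l c) * (X $ a $ b * (c $ (i, f a) * cnj (c $ (j, f b)))))"
      by (simp add: cscale_nth T_unit sum_distrib_left mult_ac)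
    then show ?thesis
      by (simp add: sum.swap[of _ B])
  qed
  \<comment> \<open>\<open>g c\<close> is the adjoint of the Kraus matrix with entries
    \<open>c $ (i, f a)\<close>.\<close>
  define g :: "complex ^ ('s \<times> 'a) \<Rightarrow> complex ^ 's \<Rightarrow> complex ^ 's"
    where "g = (\<lambda>c v. \<chi> a. \<Sum>i\<in>UNIV. cnj (c $ (i, f a)) * v $ i)"
  have T_form: "cinner v (T X *v w) = (\<Sum>c\<in>B. of_real (l c) * cinner (g c v) (X *v g c w))" for X v w
  proof -
    have "of_real (l c) * cinner (g c v) (X *v g c w) = (\<Sum>i\<in>UNIV. \<Sum>j\<in>UNIV. \<Sum>a\<in>UNIV. \<Sum>b\<in>UNIV.
        cnj (v $ i) * (of_real (l c) * (X $ a $ b * (c $ (i, f a) * cnj (c $ (j, f b)))) * w $ j))"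
      (is "?L = (\<Sum>i\<in>_. \<Sum>j\<in>_. \<Sum>a\<in>_. \<Sum>b\<in>_. ?F i j a b)") for c
    proof -
      have "?L = (\<Sum>a\<in>UNIV. \<Sum>b\<in>UNIV. \<Sum>j\<in>UNIV. \<Sum>i\<in>UNIV. ?F i j a b)"
        by (simp add: cinner_def matrix_vector_mult_def g_def sum_distrib_left sum_distrib_right mult_ac)
      also have "\<dots> = (\<Sum>a\<in>UNIV. \<Sum>b\<in>UNIV. \<Sum>i\<in>UNIV. \<Sum>j\<in>UNIV. ?F i j a b)"
        by (rule sum.cong[OF refl], rule sum.cong[OF refl], rule sum.swap)
      also have "\<dots> = (\<Sum>a\<in>UNIV. \<Sum>i\<in>UNIV. \<Sum>b\<in>UNIV. \<Sum>j\<in>UNIV. ?F i j a b)"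
        by (rule sum.cong[OF refl], rule sum.swap)
      also have "\<dots> = (\<Sum>i\<in>UNIV. \<Sum>a\<in>UNIV. \<Sum>b\<in>UNIV. \<Sum>j\<in>UNIV. ?F i j a b)"
        by (rule sum.swap)
      also have "\<dots> = (\<Sum>i\<in>UNIV. \<Sum>a\<in>UNIV. \<Sum>j\<in>UNIV. \<Sum>b\<in>UNIV. ?F i j a b)"
        by (rule sum.cong[OF refl], rule sum.cong[OF refl], rule sum.swap)
      also have "\<dots> = (\<Sum>i\<in>UNIV. \<Sum>j\<in>UNIV. \<Sum>a\<in>UNIV. \<Sum>b\<in>UNIV. ?F i j a b)"
        by (rule sum.cong[OF refl], rule sum.swap)
      finally show ?thesis .
    qed
    moreover have "cinner v (T X *v w) = (\<Sum>i\<in>UNIV. \<Sum>j\<in>UNIV. \<Sum>c\<in>B. \<Sum>a\<in>UNIV. \<Sum>b\<in>UNIV.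
        cnj (v $ i) * (of_real (l c) * (X $ a $ b * (c $ (i, f a) * cnj (c $ (j, f b)))) * w $ j))"
      by (simp add: cinner_def matrix_vector_mult_def T_nth sum_distrib_left sum_distrib_right)
    ultimately show ?thesis
      by (simp add: sum.swap[of _ B])
  qed
  show ?thesis
    unfolding completely_positive_def
  proof (intro allI impI)
    fix k and X :: "nat \<Rightarrow> nat \<Rightarrow> 's op"
    assume X: "psd_blocks k X"
    show "psd_blocks k (\<lambda>a b. T (X a b))"
      unfolding psd_blocks_def
    proof
      fix v :: "nat \<Rightarrow> complex ^ 's"
      \<comment> \<open>The form of the image array at \<open>v\<close> is a combination, with
        weights \<open>l c \<ge> 0\<close>, of the forms of \<open>X\<close> at the vectors
        \<open>g c (v a)\<close>.\<close>
      have "(\<Sum>a<k. \<Sum>b<k. cinner (v a) (T (X a b) *v v b)) =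
          (\<Sum>c\<in>B. of_real (l c) * (\<Sum>a<k. \<Sum>b<k. cinner (g c (v a)) (X a b *v g c (v b))))"
        by (simp add: T_form sum_distrib_left sum.swap[of _ B])
      also have "\<dots> \<in> \<real>\<^sub>\<ge>\<^sub>0"
      proof (rule nonneg_Reals_sum)
        fix c
        assume "c \<in> B"
        moreover have "(\<Sum>a<k. \<Sum>b<k. cinner (g c (v a)) (X a b *v g c (v b))) \<in> \<real>\<^sub>\<ge>\<^sub>0"
          using X[unfolded psd_blocks_def, rule_format, of "\<lambda>a. g c (v a)"] .
        ultimately show "of_real (l c) * (\<Sum>a<k. \<Sum>b<k. cinner (g c (v a)) (X a b *v g c (v b))) \<in> \<real>\<^sub>\<ge>\<^sub>0"
          using l by (intro nonneg_Reals_mult_I) auto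
      qed
      finally show "(\<Sum>a<k. \<Sum>b<k. cinner (v a) (T (X a b) *v v b)) \<in> \<real>\<^sub>\<ge>\<^sub>0" .
    qed
  qed
qed


section \<open>Monotonicity of quantifiers along the dynamics\<close>

lemma apply_ensemble_mem:
  assumes "positive_map T" "trace_preserving T" "E \<in> ensembles_of_size n"
  shows "apply_ensemble T E \<in> ensembles_of_size n"
proof -
  have "map fst (apply_ensemble T E) = map fst E"
    by (simp add: apply_ensemble_def case_prod_unfold comp_def)
  moreover have "T \<rho> \<in> density" if "\<rho> \<in> density" for \<rho>
    using that by (rule positive_map_density[OF assms(1,2)])
  ultimately show ?thesis
    using assms(3) unfolding ensembles_of_size_def
    by (simp only: mem_Collect_eq) (auto simp: apply_ensemble_def)
qed

lemma apply_ensemble_compose: "apply_ensemble (S \<circ> T) E = apply_ensemble S (apply_ensemble T E)"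
  by (simp add: apply_ensemble_def case_prod_unfold comp_def)

text \<open>Abstract in \<open>M\<close> and \<open>\<T>\<close>, so that one argument covers both
  the system and the system-ancilla case. The later ensemble is the earlier one processed by some
  \<open>W\<close> in \<open>\<T>\<close>, so the defining inequality of a quantifier
  applies.\<close>

lemma quantifier_antimono:
  fixes M :: "real \<Rightarrow> 'n::finite op \<Rightarrow> 'n op"
  assumes I: "quantifier \<T> I" and E: "E \<in> ensembles"
    and M: "\<And>t. 0 \<le> t \<Longrightarrow> positive_map (M t) \<and> trace_preserving (M t)"
    and W: "\<And>s t. 0 \<le> s \<Longrightarrow> s < t \<Longrightarrow> \<exists>W\<in>\<T>. M t = W \<circ> M s"
  shows "antimono_on {0..} (\<lambda>t. I (apply_ensemble (M t) E))"
proof (rule monotone_onI)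
  fix s t :: real
  assume s: "s \<in> {0..}" and "t \<in> {0..}" and "s \<le> t"
  show "I (apply_ensemble (M t) E) \<le> I (apply_ensemble (M s) E)"
  proof (cases "s = t")
    case False
    then obtain W where "W \<in> \<T>" "M t = W \<circ> M s"
      using W[of s t] s \<open>s \<le> t\<close> by auto
    moreover have "apply_ensemble (M s) E \<in> ensembles"
    proof -
      obtain n where "n \<ge> 1" "E \<in> ensembles_of_size n"
        using E by (auto simp: ensembles_def)
      moreover have "positive_map (M s)" "trace_preserving (M s)"
        using M s by auto
      ultimately show ?thesis
        using apply_ensemble_mem unfolding ensembles_def by blast
    qed
    ultimately show ?thesis
      using I by (simp add: quantifier_def apply_ensemble_compose)
  qed simp
qed

lemma cptp_positive:
  assumes "T \<in> cptp"
  shows "positive_map T" "positive_map (tensor_id T)"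
    "trace_preserving T" "trace_preserving (tensor_id T)"
  using assms
  by (simp_all add: cptp_def completely_positive_positive_map completely_positive_tensor_id
      trace_preserving_tensor_id)

lemma CPD_cptp_propagator:
  assumes \<Lambda>: "invertible_dynamics \<Lambda>" and "CPD \<Lambda>" and st: "0 \<le> s" "s < t"
  shows "\<exists>V\<in>cptp. \<Lambda> t = V \<circ> \<Lambda> s"
proof -
  obtain V where "propagator \<Lambda> V" and CP: "\<forall>s t. 0 \<le> s \<and> s < t \<longrightarrow> completely_positive (V t s)"
    using \<open>CPD \<Lambda>\<close> by (auto simp: CPD_def)
  then have V: "op_linear (V t s)" "\<Lambda> t = V t s \<circ> \<Lambda> s" "completely_positive (V t s)"
    using st unfolding propagator_def by blast+
  have tp: "trace_preserving (\<Lambda> s)" "trace_preserving (\<Lambda> t)" and "invertible_map (\<Lambda> s)"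
    using \<Lambda> st by (auto simp: invertible_dynamics_def dynamics_def cptp_def)
  then obtain L where L: "\<Lambda> s \<circ> L = id"
    by (auto simp: invertible_map_def)
  \<comment> \<open>Pull \<open>A\<close> back to \<open>L A\<close>: both \<open>A\<close> and
    \<open>V t s A\<close> are images of it under trace-preserving maps.\<close>
  have "trace (V t s A) = trace A" for A
  proof -
    have "V t s A = \<Lambda> t (L A)" "A = \<Lambda> s (L A)"
      using L by (auto simp: V(2) fun_eq_iff)
    then show ?thesis
      using tp by (metis trace_preserving_def)
  qed
  then show ?thesis
    using V by (auto simp: cptp_def trace_preserving_def)
qed

lemma CPD_imp_S_Markovian:
  assumes "invertible_dynamics \<Lambda>" "CPD \<Lambda>"
  shows "S_Markovian \<Lambda>"
proof -
  have cptp: "\<Lambda> t \<in> cptp" if "0 \<le> t" for t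
    using assms that by (simp add: invertible_dynamics_def dynamics_def)
  have "antimono_on {0..} (\<lambda>t. I (apply_ensemble (\<Lambda> t) E))"
    if "quantifier cptp I" "E \<in> ensembles" for I E
    using that
    by (rule quantifier_antimono) (simp_all add: cptp cptp_positive CPD_cptp_propagator assms)
  then show ?thesis
    unfolding S_Markovian_def n_S_Markovian_def S_dynamic_def S_PQ_def ensembles_def by blast
qed

lemma CPD_imp_SA_Markovian:
  fixes \<Lambda> :: "real \<Rightarrow> 's::finite op \<Rightarrow> 's op"
  assumes "invertible_dynamics \<Lambda>" "CPD \<Lambda>"
  shows "SA_Markovian TYPE('a::finite) \<Lambda>"
proof -
  have cptp: "\<Lambda> t \<in> cptp" if "0 \<le> t" for t
    using assms that by (simp add: invertible_dynamics_def dynamics_def)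
  have "antimono_on {0..} (\<lambda>t. I (apply_ensemble (tensor_id (\<Lambda> t)) E))"
    if "quantifier (tensor_id ` cptp) I" "E \<in> ensembles" for I and E :: "('s \<times> 'a) ensemble"
    using that
  proof (rule quantifier_antimono)
    show "\<exists>W\<in>tensor_id ` cptp. tensor_id (\<Lambda> t) = W \<circ> tensor_id (\<Lambda> s)"
      if "0 \<le> s" "s < t" for s t
      using CPD_cptp_propagator[OF assms that] by (metis tensor_id_compose imageI)
  qed (simp add: cptp cptp_positive)
  then show ?thesis
    unfolding SA_Markovian_def n_SA_Markovian_def SA_dynamic_def SA_PQ_def ensembles_def by blast
qed


section \<open>The generalized trace-distance quantifier\<close>

lemma GTDE_eq_0: "length E \<noteq> 2 \<Longrightarrow> GTDE E = 0"
  by (cases E rule: GTDE.cases) auto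

lemma ensembles_of_size_2_cases:
  assumes "E \<in> ensembles" "length E = 2"
  obtains p\<^sub>1 p\<^sub>2 \<xi>\<^sub>1 \<xi>\<^sub>2 where "E = [(p\<^sub>1, \<xi>\<^sub>1), (p\<^sub>2, \<xi>\<^sub>2)]" "0 \<le> p\<^sub>1" "0 \<le> p\<^sub>2" "p\<^sub>1 + p\<^sub>2 = 1"
    "psd \<xi>\<^sub>1" "psd \<xi>\<^sub>2" "trace \<xi>\<^sub>1 = 1" "trace \<xi>\<^sub>2 = 1"
proof -
  obtain x y where "E = [x, y]"
    using assms(2) by (auto simp: length_Suc_conv numeral_2_eq_2)
  then show thesis
    using assms that[of "fst x" "snd x" "fst y" "snd y"]
    by (auto simp: ensembles_def ensembles_of_size_def density_def)
qed

text \<open>The bound 1 is the sum of the traces of the two weighted states; monotonicity is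
  contraction of the trace norm under \<open>tensor_id T\<close>.\<close>

lemma SA_PQ_GTDE: "SA_PQ (GTDE :: ('s::finite \<times> 'a::finite) ensemble \<Rightarrow> real)"
proof -
  have bounds: "0 \<le> GTDE E \<and> GTDE E \<le> 1" if E: "E \<in> ensembles" for E :: "('s \<times> 'a) ensemble"
  proof (cases "length E = 2")
    case True
    with E show ?thesis
    proof (cases rule: ensembles_of_size_2_cases)
      case (1 p q \<xi> \<eta>)
      then have "psd (p *\<^sub>R \<xi>)" "psd (q *\<^sub>R \<eta>)"
        by (simp_all add: psd_scaleR)
      then show ?thesis
        using 1 trace_norm_diff_le[of "p *\<^sub>R \<xi>" "q *\<^sub>R \<eta>"] trace_norm_nonneg[of "p *\<^sub>R \<xi> - q *\<^sub>R \<eta>"]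
        by (simp add: trace_scaleR dagger_diff psd_imp_hermitian)
    qed
  qed (simp add: GTDE_eq_0)
  have contract: "GTDE (apply_ensemble (tensor_id T) E) \<le> GTDE E"
    if T: "T \<in> cptp" and E: "E \<in> ensembles" for T and E :: "('s \<times> 'a) ensemble"
  proof (cases "length E = 2")
    case True
    with E show ?thesis
    proof (cases rule: ensembles_of_size_2_cases)
      case (1 p q \<xi> \<eta>)
      then have "dagger (p *\<^sub>R \<xi> - q *\<^sub>R \<eta>) = p *\<^sub>R \<xi> - q *\<^sub>R \<eta>"
        by (simp add: dagger_diff dagger_scaleR psd_imp_hermitian)
      moreover have "op_linear (tensor_id T :: ('s \<times> 'a) op \<Rightarrow> _)"
        using T by (simp add: cptp_def op_linear_tensor_id)
      ultimately show ?thesis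
        using trace_norm_contract[of "tensor_id T" "p *\<^sub>R \<xi> - q *\<^sub>R \<eta>"] cptp_positive[OF T] 1
        by (simp add: apply_ensemble_def op_linear_diff op_linear_scaleR)
    qed
  next
    case False
    then show ?thesis
      by (simp add: GTDE_eq_0 apply_ensemble_def)
  qed
  show ?thesis
    unfolding SA_PQ_def quantifier_def using bounds contract by blast
qed

section \<open>From 2-SA-Markovianity through GTDE-Markovianity to divisibility\<close>

lemma two_SA_Markovian_imp_GTDE_Markovian:
  fixes \<Lambda> :: "real \<Rightarrow> 's::finite op \<Rightarrow> 's op"
  assumes "n_SA_Markovian TYPE('a::finite) 2 \<Lambda>"
  shows "GTDE_Markovian TYPE('a) \<Lambda>"
  unfolding GTDE_Markovian_def
proof
  fix E :: "('s \<times> 'a) ensemble"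
  assume E: "E \<in> ensembles"
  show "antimono_on {0..} (SA_dynamic \<Lambda> GTDE E)"
  proof (cases "length E = 2")
    case True
    then have "E \<in> ensembles_of_size 2"
      using E by (auto simp: ensembles_def ensembles_of_size_def)
    moreover have "supported_on_size 2 (GTDE :: ('s \<times> 'a) ensemble \<Rightarrow> real)"
      unfolding supported_on_size_def
    proof
      fix E :: "('s \<times> 'a) ensemble"
      assume "E \<in> ensembles - ensembles_of_size 2"
      then show "GTDE E = 0"
        by (intro GTDE_eq_0) (auto simp: ensembles_def ensembles_of_size_def)
    qed
    ultimately show ?thesis
      using assms SA_PQ_GTDE unfolding n_SA_Markovian_def by blast
  next
    case False
    then have "SA_dynamic \<Lambda> GTDE E = (\<lambda>_. 0)"
      by (simp add: SA_dynamic_def GTDE_eq_0 apply_ensemble_def fun_eq_iff)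
    then show ?thesis
      by (simp add: monotone_on_def)
  qed
qed

text \<open>Unnormalized form of the hypothesis: the traces of \<open>P\<close> and \<open>Q\<close>
  serve as probabilities, and their positivity allows dividing by them to obtain states.\<close>

lemma GTDE_Markovian_trace_norm:
  fixes \<Lambda> :: "real \<Rightarrow> 's::finite op \<Rightarrow> 's op" and P Q :: "('s \<times> 'a::finite) op"
  assumes G: "GTDE_Markovian TYPE('a) \<Lambda>" and lin: "\<And>t. 0 \<le> t \<Longrightarrow> op_linear (\<Lambda> t)"
    and st: "0 \<le> s" "s \<le> t"
    and P: "psd P" "0 < Re (trace P)" and Q: "psd Q" "0 < Re (trace Q)"
    and total: "Re (trace P) + Re (trace Q) = 1"
  shows "trace_norm (tensor_id (\<Lambda> t) (P - Q)) \<le> trace_norm (tensor_id (\<Lambda> s) (P - Q))"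
proof -
  define p where "p = Re (trace P)"
  define q where "q = Re (trace Q)"
  have pq: "p > 0" "q > 0" "p + q = 1"
    using P Q total by (simp_all add: p_def q_def)
  let ?E = "[(p, (1/p) *\<^sub>R P), (q, (1/q) *\<^sub>R Q)]"
  have "trace P = of_real p" "trace Q = of_real q"
    using psd_trace_real P Q by (auto simp: p_def q_def)
  then have "?E \<in> ensembles_of_size 2"
    using pq P Q by (simp add: ensembles_of_size_def density_def psd_scaleR trace_scaleR)
  then have "?E \<in> ensembles"
    by (auto simp: ensembles_def)
  then have "SA_dynamic \<Lambda> GTDE ?E t \<le> SA_dynamic \<Lambda> GTDE ?E s"
    using G st unfolding GTDE_Markovian_def monotone_on_def by auto
  moreover have "op_linear (tensor_id (\<Lambda> r) :: ('s \<times> 'a) op \<Rightarrow> _)" if "0 \<le> r" for r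
    using lin that by (simp add: op_linear_tensor_id)
  then have "SA_dynamic \<Lambda> GTDE ?E r = trace_norm (tensor_id (\<Lambda> r) (P - Q))" if "0 \<le> r" for r
    using that pq by (simp add: SA_dynamic_def apply_ensemble_def op_linear_diff op_linear_scaleR)
  ultimately show ?thesis
    using st by simp
qed

text \<open>
  On positive \<open>X\<close> the propagator preserves the trace and does not increase the trace norm, so the
  trace norm of the image of \<open>X\<close> is at most its trace; this forces the image to be positive.
\<close>

lemma GTDE_Markovian_imp_CPD:
  fixes \<Lambda> :: "real \<Rightarrow> 's::finite op \<Rightarrow> 's op"
  assumes card: "CARD('s) = CARD('a::finite)" and \<Lambda>: "invertible_dynamics \<Lambda>"
    and G: "GTDE_Markovian TYPE('a) \<Lambda>"
  shows "CPD \<Lambda>"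
proof -
  have cptp: "\<Lambda> t \<in> cptp" if "0 \<le> t" for t
    using \<Lambda> that by (simp add: invertible_dynamics_def dynamics_def)
  then have lin: "op_linear (\<Lambda> t)" if "0 \<le> t" for t
    using that by (simp add: cptp_def)
  obtain L where L: "\<And>s. 0 \<le> s \<Longrightarrow> op_linear (L s) \<and> L s \<circ> \<Lambda> s = id \<and> \<Lambda> s \<circ> L s = id"
    using \<Lambda> unfolding invertible_dynamics_def invertible_map_def by metis
  \<comment> \<open>Equal dimensions enter here, providing the matching of bases for Choi's
    theorem.\<close>
  obtain f :: "'s \<Rightarrow> 'a" where f: "bij f"
    using card finite_same_card_bij[of "UNIV :: 's set" "UNIV :: 'a set"] by auto
  have CP: "completely_positive (\<Lambda> t \<circ> L s)" if st: "0 \<le> s" "s < t" for s t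
  proof (rule choi[OF _ f])
    have t: "0 \<le> t"
      using st by simp
    show "op_linear (\<Lambda> t \<circ> L s)"
      using L st lin[OF t] by (simp add: op_linear_compose)
    fix X :: "('s \<times> 'a) op"
    assume X: "psd X"
    let ?S = "tensor_id (\<Lambda> s) :: ('s \<times> 'a) op \<Rightarrow> _" and ?T = "tensor_id (\<Lambda> t) :: ('s \<times> 'a) op \<Rightarrow> _"
      and ?L = "tensor_id (L s) :: ('s \<times> 'a) op \<Rightarrow> _"
    have SL: "?S (?L A) = A" and LS: "?L (?S A) = A" for A
      using L[OF st(1)] tensor_id_compose tensor_id_id by (metis comp_apply id_apply)+
    \<comment> \<open>The preimage of \<open>X\<close> under \<open>?S\<close>; the goal becomes
      positivity of \<open>?T Y\<close>.\<close>
    define Y where "Y = ?L X"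
    have pos: "positive_map ?S" "positive_map ?T"
      and tp: "trace_preserving ?S" "trace_preserving ?T"
      using cptp cptp_positive st t by blast+
    have "?S (dagger Y) = ?S Y"
      using positive_map_dagger[OF pos(1)] by (simp add: Y_def SL psd_imp_hermitian X)
    then have Y: "dagger Y = Y"
      using LS by metis
    obtain P Q where PQ: "psd P" "psd Q" "Y = P - Q"
      using jordan_decomposition[OF Y] by metis
    \<comment> \<open>Adding the identity to both parts preserves their difference and makes both
      traces strictly positive, even if a part is zero. The factor \<open>r\<close> below then
      normalizes the total trace to 1.\<close>
    define P' where "P' = P + mat 1"
    define Q' where "Q' = Q + mat 1"
    have PQ': "psd P'" "psd Q'" "Y = P' - Q'"
      using PQ by (simp_all add: P'_def Q'_def psd_add psd_mat_1)
    have "trace (mat 1 :: ('s \<times> 'a) op) = of_nat CARD('s \<times> 'a)"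
      by (simp add: trace_I)
    then have tr: "0 < Re (trace P')" "0 < Re (trace Q')"
      using psd_trace_nonneg[OF PQ(1)] psd_trace_nonneg[OF PQ(2)]
      by (simp_all add: P'_def Q'_def trace_add add_nonneg_pos)
    define r where "r = 1 / (Re (trace P') + Re (trace Q'))"
    have r: "r > 0" "r * Re (trace P') + r * Re (trace Q') = 1"
      using tr by (simp_all add: r_def flip: add_divide_distrib)
    \<comment> \<open>The right-hand side is the trace norm of \<open>r X\<close>, which is its
      trace because \<open>X\<close> is positive, and hence the trace of
      \<open>?T (r Y)\<close>.\<close>
    have "trace_norm (?T (r *\<^sub>R P' - r *\<^sub>R Q')) \<le> trace_norm (?S (r *\<^sub>R P' - r *\<^sub>R Q'))"
      using st r tr PQ' by (intro GTDE_Markovian_trace_norm[OF G lin]) (simp_all add: psd_scaleR trace_scaleR)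
    moreover have "r *\<^sub>R P' - r *\<^sub>R Q' = r *\<^sub>R Y"
      by (simp add: PQ'(3) scaleR_diff_right)
    moreover have "?S (r *\<^sub>R Y) = r *\<^sub>R X"
      using pos by (simp add: Y_def positive_map_def op_linear_scaleR SL)
    moreover have "trace_norm (r *\<^sub>R X) = Re (trace (r *\<^sub>R X))"
      using X r by (simp add: trace_norm_psd psd_scaleR)
    moreover have "trace (?T (r *\<^sub>R Y)) = trace (?S (r *\<^sub>R Y))"
      using tp by (simp add: trace_preserving_def)
    ultimately have "trace_norm (?T (r *\<^sub>R Y)) \<le> Re (trace (?T (r *\<^sub>R Y)))"
      by simp
    moreover have "dagger (?T (r *\<^sub>R Y)) = ?T (r *\<^sub>R Y)"
      by (rule positive_map_hermitian[OF pos(2)]) (simp add: dagger_scaleR Y)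
    ultimately have "psd (?T (r *\<^sub>R Y))"
      by (rule psd_if_trace_norm_le_trace[rotated])
    then have "psd ((1 / r) *\<^sub>R ?T (r *\<^sub>R Y))"
      using r by (intro psd_scaleR) simp_all
    then show "psd (tensor_id (\<Lambda> t \<circ> L s) X)"
      using r pos by (simp add: tensor_id_compose Y_def positive_map_def op_linear_scaleR)
  qed
  have "propagator \<Lambda> (\<lambda>t s. \<Lambda> t \<circ> L s)"
    using L lin by (auto simp: propagator_def comp_assoc intro!: op_linear_compose)
  then show ?thesis
    using CP unfolding CPD_def by (intro exI[of _ "\<lambda>t s. \<Lambda> t \<circ> L s"]) auto
qed

theorem theorem2:
  fixes \<Lambda> :: "real \<Rightarrow> 's::finite op \<Rightarrow> 's op"
  assumes "CARD('s) = CARD('a::finite)"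
    and "invertible_dynamics \<Lambda>"
  shows "(GTDE_Markovian TYPE('a) \<Lambda> \<longleftrightarrow> CPD \<Lambda>) \<and>
         (CPD \<Lambda> \<longleftrightarrow> SA_Markovian TYPE('a) \<Lambda>) \<and>
         (SA_Markovian TYPE('a) \<Lambda> \<longleftrightarrow> IB_Markovian TYPE('a) \<Lambda>) \<and>
         (IB_Markovian TYPE('a) \<Lambda> \<longleftrightarrow> n_SA_Markovian TYPE('a) 2 \<Lambda>)"
proof -
  \<comment> \<open>The implications close the cycle SA, 2-SA, GTDE, CPD, SA; the further
    implication from CPD to S-Markovianity brings in IB.\<close>
  have "n_SA_Markovian TYPE('a) 2 \<Lambda>" if "SA_Markovian TYPE('a) \<Lambda>"
    using that unfolding SA_Markovian_def by (elim allE[of _ 2]) simp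
  moreover have "GTDE_Markovian TYPE('a) \<Lambda>" if "n_SA_Markovian TYPE('a) 2 \<Lambda>"
    using that by (rule two_SA_Markovian_imp_GTDE_Markovian)
  moreover have "CPD \<Lambda>" if "GTDE_Markovian TYPE('a) \<Lambda>"
    using assms that by (rule GTDE_Markovian_imp_CPD)
  moreover have "SA_Markovian TYPE('a) \<Lambda>" if "CPD \<Lambda>"
    using assms(2) that by (rule CPD_imp_SA_Markovian)
  moreover have "S_Markovian \<Lambda>" if "CPD \<Lambda>"
    using assms(2) that by (rule CPD_imp_S_Markovian)
  ultimately show ?thesis
    unfolding IB_Markovian_def by argo
qed

end
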